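(* Let $N_1,N_2\in\mathbb{N}$ and $\Delta>0$, and let $P=(\{y_n\}_{n=1}^{N_1},\{\lambda_n\}_{n=1}^{N_1})$. There exist $\varepsilon_*>0$ and functions $\{\hat y_n(\varepsilon)\}_{n=1}^{N_1}$ and $\{\hat\lambda_n(\varepsilon)\}_{n=1}^{N_1}$, defined and continuously differentiable on $(-\varepsilon_*,\varepsilon_* )$, such that $\hat P(\varepsilon):=(\{\hat y_n(\varepsilon)\}_{n=1}^{N_1},\{\hat\lambda_n(\varepsilon)\}_{n=1}^{N_1})$ satisfies $\hat P(0)=P$ and $$\forall \varepsilon\in(-\varepsilon_*,\varepsilon_* )\qquad \mathcal{F}(\hat P,\varepsilon)=0\iff \hat P=\hat P(\varepsilon).$$ Furthermore, the first-order condition numbers $\mathcal{K}_y(n):=\frac{\mathrm{d}\hat y_n}{\mathrm{d}\varepsilon}(0)$ and $\mathcal{K}_\lambda(n):=\frac{\mathrm{d}\hat\lambda_n}{\mathrm{d}\varepsilon}(0)$, $n=1,\dots,N_1$, have the explicit expressions $$\mathcal{K}_y(n)=\sum_{m=N_1+1}^{N_1+N_2}y_m H_n(\phi_m),\qquad \mathcal{K}_\lambda(n)=-\frac{1}{\Delta y_n\phi_n}\sum_{m=N_1+1}^{N_1+N_2}y_m\tilde H_n(\phi_m).$$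
   Context: Let $\mathcal{A}$ be a fixed Sturm-Liouville operator $[\mathcal{A}h](x)=-(p(x)h'(x))'-q(x)h(x)$, $x\in(0,1)$, with domain $\{h\in \mathrm{H}^2(0,1): h(0)=h(1)=0\}$, where $p,q$ are smooth functions on $[0,1]$ (restrictions of smooth functions defined on a neighborhood of $[0,1]$) and $\min_{[0,1]}p>0$. Let $\{\lambda_n\}_{n=1}^\infty$ be the monotonically increasing, unbounded real sequence of its simple eigenvalues. Put $\phi_n:=e^{-\lambda_n\Delta}$. The real amplitudes $y_1,\dots,y_{N_1+N_2}$ satisfy: there is $\ell>1$ with $\ell^{-1}\le|y_n|\le\ell$ for $1\le n\le N_1$, and there is $M_y>0$ with $|y_n|/|y_k|\le M_y$ for all $1\le k\le N_1$ and $N_1+1\le n\le N_1+N_2$. The function $\mathcal{F}:\mathbb{R}^{2N_1+1}\to\mathbb{R}^{2N_1}$ is defined, for a candidate $\hat P=(\{\hat y_n\}_{n=1}^{N_1},\{\hat\lambda_n\}_{n=1}^{N_1})$ and $\varepsilon\in\mathbb{R}$, by $$\mathcal{F}(\hat P,\varepsilon)=\Big(\sum_{n=1}^{N_1}\hat y_n e^{-\hat\lambda_n k\Delta}-\sum_{n=1}^{N_1}y_n e^{-\lambda_n k\Delta}-\varepsilon\sum_{n=N_1+1}^{N_1+N_2}y_n e^{-\lambda_n k\Delta}\Big)_{k=0}^{2N_1-1}.$$ The Lagrange basis with nodes $\phi_1,\dots,\phi_{N_1}$ is $L_n(z)=\prod_{j\in\{1,\dots,N_1\},\,j\ne n}\frac{z-\phi_j}{\phi_n-\phi_j}$,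 and the Hermite basis with these nodes is $H_n(z)=[1-2(z-\phi_n)L_n'(\phi_n)]L_n(z)^2$, $\tilde H_n(z)=(z-\phi_n)L_n(z)^2$.
   Formalization: For N1≥2 the equivalence fails for arbitrary labelled P̂ (swap two pairs at ε=0); it is proved for P̂ with λ̂_1<…<λ̂_{N1}, and for every P̂ in the form: F(P̂,ε)=0 iff P̂ equals P̂(ε) up to a simultaneous permutation of the pairs (ŷ_n,λ̂_n). *)

theory Defs
  imports "HOL-Analysis.Analysis" "HOL-Combinatorics.Permutations"
begin

section \<open>The Sturm-Liouville operator on (0,1)\<close>

definition smooth_on :: "real set \<Rightarrow> (real \<Rightarrow> real) \<Rightarrow> bool" where
  "smooth_on S f \<longleftrightarrow> open S \<and> (\<forall>k. \<forall>x\<in>S. ((deriv ^^ k) f) differentiable (at x))"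

definition smooth_unit_interval :: "(real \<Rightarrow> real) \<Rightarrow> bool" where
  "smooth_unit_interval f \<longleftrightarrow>
     (\<exists>g S. smooth_on S g \<and> {0..1} \<subseteq> S \<and> (\<forall>x\<in>{0..1}. f x = g x))"

definition test_function :: "(real \<Rightarrow> real) \<Rightarrow> bool" where
  "test_function \<psi> \<longleftrightarrow> smooth_on UNIV \<psi> \<and> closure {x. \<psi> x \<noteq> 0} \<subseteq> {0<..<1}"

definition L2_unit :: "(real \<Rightarrow> real) \<Rightarrow> bool" where
  "L2_unit f \<longleftrightarrow> set_borel_measurable lebesgue {0<..<1} f
     \<and> set_integrable lebesgue {0<..<1} (\<lambda>x. (f x)\<^sup>2)"

definition weak_deriv :: "(real \<Rightarrow> real) \<Rightarrow> (real \<Rightarrow> real) \<Rightarrow> bool" where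
  "weak_deriv f g \<longleftrightarrow> (\<forall>\<psi>. test_function \<psi> \<longrightarrow>
     (LINT x:{0<..<1}|lebesgue. f x * deriv \<psi> x) =
       - (LINT x:{0<..<1}|lebesgue. g x * \<psi> x))"

definition H2_unit :: "(real \<Rightarrow> real) \<Rightarrow> bool" where
  "H2_unit h \<longleftrightarrow> L2_unit h \<and>
     (\<exists>g1 g2. L2_unit g1 \<and> L2_unit g2 \<and> weak_deriv h g1 \<and> weak_deriv g1 g2)"

text \<open>An element of \<open>H\<^sup>2(0,1)\<close> is represented by its continuous representative on \<open>[0,1]\<close>, so
  that the boundary values are point values.\<close>

definition SL_domain :: "(real \<Rightarrow> real) \<Rightarrow> bool" where
  "SL_domain h \<longleftrightarrow> H2_unit h \<and> continuous_on {0..1} h \<and> h 0 = 0 \<and> h 1 = 0"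

text \<open>\<open>SL_operator p q h f\<close> is the graph of \<open>\<A>\<close>: \<open>h\<close> lies in the domain and
  \<open>f = -(p h')' - q h\<close> as elements of \<open>L\<^sup>2(0,1)\<close>, where \<open>g = h'\<close> and \<open>k = (p h')'\<close>.\<close>

definition SL_operator ::
  "(real \<Rightarrow> real) \<Rightarrow> (real \<Rightarrow> real) \<Rightarrow> (real \<Rightarrow> real) \<Rightarrow> (real \<Rightarrow> real) \<Rightarrow> bool" where
  "SL_operator p q h f \<longleftrightarrow> SL_domain h \<and>
     (\<exists>g k. L2_unit g \<and> L2_unit k \<and> weak_deriv h g \<and> weak_deriv (\<lambda>x. p x * g x) k \<and>
        (AE x in lebesgue. x \<in> {0<..<1} \<longrightarrow> f x = - k x - q x * h x))"

definition SL_eigenfunction ::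
  "(real \<Rightarrow> real) \<Rightarrow> (real \<Rightarrow> real) \<Rightarrow> real \<Rightarrow> (real \<Rightarrow> real) \<Rightarrow> bool" where
  "SL_eigenfunction p q \<mu> h \<longleftrightarrow>
     SL_operator p q h (\<lambda>x. \<mu> * h x) \<and> (\<exists>x\<in>{0..1}. h x \<noteq> 0)"

definition SL_eigenvalue :: "(real \<Rightarrow> real) \<Rightarrow> (real \<Rightarrow> real) \<Rightarrow> real \<Rightarrow> bool" where
  "SL_eigenvalue p q \<mu> \<longleftrightarrow> (\<exists>h. SL_eigenfunction p q \<mu> h)"

definition SL_simple_eigenvalue :: "(real \<Rightarrow> real) \<Rightarrow> (real \<Rightarrow> real) \<Rightarrow> real \<Rightarrow> bool" where
  "SL_simple_eigenvalue p q \<mu> \<longleftrightarrow> SL_eigenvalue p q \<mu> \<and>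
     (\<forall>h1 h2. SL_eigenfunction p q \<mu> h1 \<longrightarrow> SL_eigenfunction p q \<mu> h2 \<longrightarrow>
        (\<exists>c. \<forall>x\<in>{0..1}. h2 x = c * h1 x))"

text \<open>Sequences are indexed from 1; the value at index 0 is irrelevant.\<close>

definition SL_eigenvalue_sequence ::
  "(real \<Rightarrow> real) \<Rightarrow> (real \<Rightarrow> real) \<Rightarrow> (nat \<Rightarrow> real) \<Rightarrow> bool" where
  "SL_eigenvalue_sequence p q lam \<longleftrightarrow>
     strict_mono_on {1..} lam \<and> filterlim lam at_top sequentially \<and>
     lam ` {1..} = {\<mu>. SL_eigenvalue p q \<mu>} \<and>
     (\<forall>n\<ge>1. SL_simple_eigenvalue p q (lam n))"


section \<open>The perturbed Prony system\<close>

definition node :: "real \<Rightarrow> (nat \<Rightarrow> real) \<Rightarrow> nat \<Rightarrow> real" where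
  "node \<Delta> lam n = exp (- lam n * \<Delta>)"

text \<open>Component \<open>k\<close> of \<open>\<F>(P\<^sub>h, \<epsilon>)\<close> for a candidate \<open>P\<^sub>h = (yh, lh)\<close>. A point of \<open>\<real>\<^bsup>2 N1\<^esup>\<close> is
  a pair of functions of which only the values on \<open>{1..N1}\<close> matter.\<close>

definition prony_map ::
  "nat \<Rightarrow> nat \<Rightarrow> real \<Rightarrow> (nat \<Rightarrow> real) \<Rightarrow> (nat \<Rightarrow> real) \<Rightarrow>
   (nat \<Rightarrow> real) \<Rightarrow> (nat \<Rightarrow> real) \<Rightarrow> real \<Rightarrow> nat \<Rightarrow> real" where
  "prony_map N1 N2 \<Delta> y lam yh lh \<epsilon> k =
     (\<Sum>n=1..N1. yh n * exp (- lh n * real k * \<Delta>))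
     - (\<Sum>n=1..N1. y n * exp (- lam n * real k * \<Delta>))
     - \<epsilon> * (\<Sum>n=N1+1..N1+N2. y n * exp (- lam n * real k * \<Delta>))"

definition prony_zero ::
  "nat \<Rightarrow> nat \<Rightarrow> real \<Rightarrow> (nat \<Rightarrow> real) \<Rightarrow> (nat \<Rightarrow> real) \<Rightarrow>
   (nat \<Rightarrow> real) \<Rightarrow> (nat \<Rightarrow> real) \<Rightarrow> real \<Rightarrow> bool" where
  "prony_zero N1 N2 \<Delta> y lam yh lh \<epsilon> \<longleftrightarrow>
     (\<forall>k<2*N1. prony_map N1 N2 \<Delta> y lam yh lh \<epsilon> k = 0)"

definition lagrange_basis :: "(nat \<Rightarrow> real) \<Rightarrow> nat \<Rightarrow> nat \<Rightarrow> real \<Rightarrow> real" where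
  "lagrange_basis \<phi> N n z = (\<Prod>j\<in>{1..N} - {n}. (z - \<phi> j) / (\<phi> n - \<phi> j))"

definition hermite_basis :: "(nat \<Rightarrow> real) \<Rightarrow> nat \<Rightarrow> nat \<Rightarrow> real \<Rightarrow> real" where
  "hermite_basis \<phi> N n z =
     (1 - 2 * (z - \<phi> n) * deriv (lagrange_basis \<phi> N n) (\<phi> n)) * (lagrange_basis \<phi> N n z)\<^sup>2"

definition hermite_basis_tilde :: "(nat \<Rightarrow> real) \<Rightarrow> nat \<Rightarrow> nat \<Rightarrow> real \<Rightarrow> real" where
  "hermite_basis_tilde \<phi> N n z = (z - \<phi> n) * (lagrange_basis \<phi> N n z)\<^sup>2"

end

theory Submission
  imports Defs
begin

text \<open>
  Put \<open>z\<^sub>n = exp (- lh\<^sub>n \<Delta>)\<close>. The equations say that the discrete measure with weights \<open>yh\<^sub>n\<close>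
  at the points \<open>z\<^sub>n\<close> has the same moments of order below \<open>2 N1\<close> as the measure \<open>\<mu>\<^sub>\<epsilon>\<close> with weights
  \<open>y\<^sub>i\<close> (for \<open>i \<le> N1\<close>) and \<open>\<epsilon> y\<^sub>i\<close> (for \<open>i > N1\<close>) at the points \<open>\<phi>\<^sub>i\<close>. So a solution is a Gauss
  quadrature rule with \<open>N1\<close> points for \<open>\<mu>\<^sub>\<epsilon>\<close>, and the proof builds this rule instead of inverting the
  Jacobian of the system.

  \<^item> Existence. A polynomial of degree \<open>N1\<close> that is \<open>\<mu>\<^sub>\<epsilon>\<close>-orthogonal to all polynomials of lower
    degree is given in closed form by Heine's formula (\<open>heine_poly_orthogonal\<close>); its coefficients are
    polynomials in \<open>\<epsilon>\<close>. At \<open>\<epsilon> = 0\<close> it is a nonzero multiple of \<open>\<Prod>\<^sub>n (t - \<phi>\<^sub>n)\<close>, because the amplitudes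
    do not vanish and the eigenvalues are distinct. Its roots are therefore simple, and the implicit
    function theorem for one unknown continues each of them to a \<open>C\<^sup>1\<close> branch \<open>z\<^sub>n\<close>
    (\<open>heine_poly_root_branch\<close>). Interpolation at the \<open>z\<^sub>n\<close> yields weights, \<open>C\<^sup>1\<close> in \<open>\<epsilon>\<close>, for which
    the rule is exact below degree \<open>2 N1\<close> (\<open>gauss_quadrature\<close>, \<open>perturbed_quadrature\<close>).
  \<^item> Uniqueness. Two rules with \<open>N1\<close> points whose moments below \<open>2 N1\<close> agree form together a relation
    between at most \<open>2 N1\<close> point evaluations, and such evaluations are linearly independent on
    polynomials of degree below \<open>2 N1\<close>. Since the constructed weights do not vanish, the rules agree
    up to the numbering of the points (\<open>power_sums_determine_nodes\<close>). This holds for every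
    candidate, not only for those close to the constructed solution; ordering the exponents removes
    the permutation.
  \<^item> Condition numbers. Differentiating \<open>\<Sum>\<^sub>n yh\<^sub>n f(z\<^sub>n) = \<integral> f d\<mu>\<^sub>\<epsilon>\<close> at \<open>\<epsilon> = 0\<close> gives
    \<open>\<Sum>\<^sub>n (yh\<^sub>n' f(\<phi>\<^sub>n) + y\<^sub>n f'(\<phi>\<^sub>n) z\<^sub>n') = \<Sum>\<^sub>m y\<^sub>m f(\<phi>\<^sub>m)\<close>, the right-hand sum being over the
    perturbing terms. The Hermite polynomials are dual to the values and the derivatives at
    the nodes, so inserting them for \<open>f\<close> isolates \<open>yh\<^sub>n'\<close> and \<open>z\<^sub>n'\<close> one at a time.
\<close>

section \<open>Continuously differentiable functions of one variable\<close>

lemma C1_differentiable_on_sum: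
  assumes "\<And>i. i \<in> A \<Longrightarrow> f i C1_differentiable_on S"
  shows "(\<lambda>x. \<Sum>i\<in>A. f i x) C1_differentiable_on S"
  using assms by (induction A rule: infinite_finite_induct) auto

lemma C1_differentiable_on_prod:
  fixes f :: "'i \<Rightarrow> real \<Rightarrow> real"
  assumes "\<And>i. i \<in> A \<Longrightarrow> f i C1_differentiable_on S"
  shows "(\<lambda>x. \<Prod>i\<in>A. f i x) C1_differentiable_on S"
  using assms by (induction A rule: infinite_finite_induct) auto

lemma C1_differentiable_on_compose_DERIV:
  fixes f g g' :: "real \<Rightarrow> real"
  assumes f: "f C1_differentiable_on S"
    and g: "\<And>x. x \<in> S \<Longrightarrow> (g has_real_derivative g' (f x)) (at (f x))"
    and g': "continuous_on (f ` S) g'"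
  shows "(\<lambda>x. g (f x)) C1_differentiable_on S"
proof -
  obtain D where D: "\<And>x. x \<in> S \<Longrightarrow> (f has_vector_derivative D x) (at x)" and cD: "continuous_on S D"
    using f unfolding C1_differentiable_on_def by blast
  have Df: "(f has_real_derivative D x) (at x)" if "x \<in> S" for x
    using D[OF that] by (simp add: has_real_derivative_iff_has_vector_derivative)
  have "continuous_on S f"
    using Df by (intro continuous_at_imp_continuous_on) (auto intro: DERIV_isCont)
  then have "continuous_on S (\<lambda>x. g' (f x) * D x)"
    by (intro continuous_on_mult cD continuous_on_compose2[OF g']) auto
  moreover have "((\<lambda>x. g (f x)) has_vector_derivative g' (f x) * D x) (at x)" if "x \<in> S" for x
    using DERIV_chain2[OF g[OF that] Df[OF that]]
    by (simp add: has_real_derivative_iff_has_vector_derivative)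
  ultimately show ?thesis
    unfolding C1_differentiable_on_def by (intro exI[of _ "\<lambda>x. g' (f x) * D x"]) simp
qed

lemma C1_differentiable_on_divide:
  fixes f g :: "real \<Rightarrow> real"
  assumes "f C1_differentiable_on S" "g C1_differentiable_on S" "\<And>x. x \<in> S \<Longrightarrow> g x \<noteq> 0"
  shows "(\<lambda>x. f x / g x) C1_differentiable_on S"
proof -
  have "(\<lambda>x. inverse (g x)) C1_differentiable_on S"
  proof (rule C1_differentiable_on_compose_DERIV[where g = inverse])
    show "(inverse has_real_derivative - (inverse (g x) ^ Suc (Suc 0))) (at (g x))" if "x \<in> S" for x
      by (rule DERIV_inverse) (use assms(3) that in simp)
    show "continuous_on (g ` S) (\<lambda>u. - (inverse u ^ Suc (Suc 0)))"
      by (intro continuous_intros) (use assms(3) in auto)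
  qed (rule assms)
  then show ?thesis
    using assms(1) by (simp add: divide_inverse)
qed

lemma C1_differentiable_on_ln:
  fixes f :: "real \<Rightarrow> real"
  assumes "f C1_differentiable_on S" "\<And>x. x \<in> S \<Longrightarrow> f x > 0"
  shows "(\<lambda>x. ln (f x)) C1_differentiable_on S"
proof (rule C1_differentiable_on_compose_DERIV[where g = ln])
  show "(ln has_real_derivative inverse (f x)) (at (f x))" if "x \<in> S" for x
    by (rule DERIV_ln) (use assms(2) that in simp)
  show "continuous_on (f ` S) inverse"
    by (intro continuous_intros) (use assms(2) in force)
qed (rule assms)

lemma C1_differentiable_on_imp_isCont:
  assumes "f C1_differentiable_on S" "x \<in> S"
  shows "isCont f x"
  using assms differentiable_imp_continuous_within unfolding C1_differentiable_on_eq by blast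

lemma C1_differentiable_on_imp_DERIV:
  fixes f :: "real \<Rightarrow> real"
  assumes "f C1_differentiable_on S" "x \<in> S"
  shows "(f has_real_derivative deriv f x) (at x)"
  using assms unfolding C1_differentiable_on_def
  by (metis DERIV_imp_deriv has_real_derivative_iff_has_vector_derivative)

lemma eventually_order_C1:
  assumes "f C1_differentiable_on {-\<delta><..<\<delta>}" "g C1_differentiable_on {-\<delta><..<\<delta>}" "\<delta> > 0" "f 0 < (g 0 :: real)"
  shows "\<forall>\<^sub>F \<epsilon> in nhds 0. f \<epsilon> < g \<epsilon>"
proof -
  have "isCont (\<lambda>\<epsilon>. g \<epsilon> - f \<epsilon>) 0"
    using assms by (intro C1_differentiable_on_imp_isCont[of _ "{-\<delta><..<\<delta>}"]) auto
  then have "((\<lambda>\<epsilon>. g \<epsilon> - f \<epsilon>) \<longlongrightarrow> g 0 - f 0) (nhds 0)"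
    using tendsto_at_iff_tendsto_nhds[of "\<lambda>\<epsilon>. g \<epsilon> - f \<epsilon>" 0] by (simp add: isCont_def)
  from order_tendstoD(1)[OF this, of 0] show ?thesis
    using assms(4) by simp
qed

lemma eventually_nonzero_C1:
  assumes "f C1_differentiable_on {-\<delta><..<\<delta>}" "\<delta> > 0" "f 0 \<noteq> (0 :: real)"
  shows "\<forall>\<^sub>F \<epsilon> in nhds 0. f \<epsilon> \<noteq> 0"
proof -
  have "isCont f 0"
    using assms by (intro C1_differentiable_on_imp_isCont[of _ "{-\<delta><..<\<delta>}"]) auto
  then have "(f \<longlongrightarrow> f 0) (nhds 0)"
    by (simp add: isCont_def tendsto_at_iff_tendsto_nhds)
  from tendsto_imp_eventually_ne[OF this assms(3)] show ?thesis .
qed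

section \<open>The implicit function theorem for one unknown\<close>

text \<open>
  The map \<open>(x, z) \<mapsto> (x, G x z)\<close> of the plane is injective on a ball on which \<open>\<partial>G/\<partial>z\<close> does not vanish, by
  Rolle's theorem on the vertical segments. By invariance of domain its image is a neighbourhood of
  \<open>(0, 0)\<close>, so the inverse map can be evaluated at \<open>(x, 0)\<close>; its second component is the solution.
\<close>

lemma implicit_function_C1:
  fixes G Gx Gz :: "real \<Rightarrow> real \<Rightarrow> real"
  assumes der: "\<And>x z. ((\<lambda>p. G (fst p) (snd p)) has_derivative
                    (\<lambda>h. Gx x z * fst h + Gz x z * snd h)) (at (x, z))"
    and contx: "continuous_on UNIV (\<lambda>p. Gx (fst p) (snd p))"
    and contz: "continuous_on UNIV (\<lambda>p. Gz (fst p) (snd p))"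
    and root: "G 0 a = 0" and simple: "Gz 0 a \<noteq> 0"
  obtains \<delta> \<zeta> where "\<delta> > 0" "\<zeta> C1_differentiable_on {-\<delta><..<\<delta>}" "\<zeta> 0 = a"
    "\<And>x. \<bar>x\<bar> < \<delta> \<Longrightarrow> G x (\<zeta> x) = 0"
proof -
  define f where "f = (\<lambda>p. (fst p, G (fst p) (snd p)))"
  have "open {p. Gz (fst p) (snd p) \<noteq> 0}"
    by (intro open_Collect_neq contz continuous_on_const)
  then obtain e where e: "e > 0" and ball: "ball (0, a) e \<subseteq> {p. Gz (fst p) (snd p) \<noteq> 0}"
    using simple by (force simp: open_contains_ball)
  define S where "S = ball (0::real, a) e"
  have S: "open S" "convex S" "(0, a) \<in> S"
    using e by (auto simp: S_def)
  have nz: "Gz x z \<noteq> 0" if "(x, z) \<in> S" for x z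
    using ball that by (auto simp: S_def)
  have derf: "(f has_derivative (\<lambda>h. (fst h, Gx x z * fst h + Gz x z * snd h))) (at (x, z))" for x z
    unfolding f_def by (rule has_derivative_Pair[OF has_derivative_fst[OF has_derivative_ident] der])
  have contf: "continuous_on S f"
    using derf by (intro continuous_at_imp_continuous_on) (auto intro: has_derivative_continuous)
  have derG: "((\<lambda>t. G x t) has_real_derivative Gz x t) (at t)" for x t
  proof -
    have "((\<lambda>t. (x, t)) has_derivative (\<lambda>h. (0, h))) (at t)"
      by (auto intro!: derivative_eq_intros)
    from diff_chain_at[OF this der] show ?thesis
      by (simp add: has_field_derivative_def o_def)
  qed
  \<comment> \<open>Two points on the same vertical line with equal values would give a zero of \<open>\<partial>G/\<partial>z\<close> between them.\<close>
  have strict: "G x z \<noteq> G x z'" if "(x, z) \<in> S" "(x, z') \<in> S" "z < z'" for x z z'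
  proof
    assume eq: "G x z = G x z'"
    have "continuous_on {z..z'} (G x)"
      by (intro continuous_at_imp_continuous_on ballI DERIV_isCont[OF derG])
    moreover have "G x differentiable (at t)" for t
      unfolding real_differentiable_def by (rule exI, rule derG)
    ultimately obtain t where t: "z < t" "t < z'" "DERIV (G x) t :> 0"
      using Rolle[OF \<open>z < z'\<close> eq] by blast
    then have "Gz x t = 0"
      using DERIV_unique derG by blast
    moreover have "(x, t) \<in> closed_segment (x, z) (x, z')"
      using t by (auto simp: closed_segment_PairD closed_segment_same_fst closed_segment_eq_real_ivl)
    then have "(x, t) \<in> S"
      using S(2) that closed_segment_subset by blast
    ultimately show False
      using nz by blast
  qed
  have inj: "inj_on f S"
  proof (rule inj_onI)
    fix p p' assume "p \<in> S" "p' \<in> S" "f p = f p'"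
    then show "p = p'"
      using strict[of "fst p" "snd p" "snd p'"] strict[of "fst p" "snd p'" "snd p"]
      by (cases p; cases p') (auto simp: f_def neq_iff intro: linorder_cases)
  qed
  have "open (f ` S)"
    by (rule invariance_of_domain[OF contf S(1) inj])
  moreover have "(0, 0) \<in> f ` S"
    using S(3) root by (force simp: f_def)
  ultimately obtain \<delta> where \<delta>: "\<delta> > 0" "ball (0, 0) \<delta> \<subseteq> f ` S"
    by (auto simp: open_contains_ball)
  define g where "g = inv_into S f"
  define \<zeta> where "\<zeta> = (\<lambda>x. snd (g (x, 0)))"
  have gS: "g (x, 0) = (x, \<zeta> x) \<and> (x, \<zeta> x) \<in> S \<and> G x (\<zeta> x) = 0" if "\<bar>x\<bar> < \<delta>" for x
  proof -
    have "(x, 0) \<in> f ` S"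
      using that \<delta>(2) by (auto simp: dist_Pair_Pair subset_iff)
    then have "g (x, 0) \<in> S" "f (g (x, 0)) = (x, 0)"
      by (auto simp: g_def inv_into_into f_inv_into_f)
    then show ?thesis
      by (cases "g (x, 0)") (auto simp: f_def \<zeta>_def)
  qed
  have der\<zeta>: "(\<zeta> has_real_derivative - Gx x (\<zeta> x) / Gz x (\<zeta> x)) (at x)" if "\<bar>x\<bar> < \<delta>" for x
  proof -
    let ?z = "\<zeta> x"
    have in_S: "(x, ?z) \<in> S" and f_eq: "f (x, ?z) = (x, 0)"
      using gS[OF that] by (auto simp: f_def)
    \<comment> \<open>The derivative of the inverse is the inverse of \<open>(u, v) \<mapsto> (u, Gx u + Gz v)\<close>.\<close>
    have "(g has_derivative (\<lambda>h. (fst h, (snd h - Gx x ?z * fst h) / Gz x ?z))) (at (f (x, ?z)))"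
    proof (rule has_derivative_inverse_strong[OF S(1) in_S contf _ derf])
      show "g (f p) = p" if "p \<in> S" for p
        using that inj by (simp add: g_def)
      show "(\<lambda>h. (fst h, Gx x ?z * fst h + Gz x ?z * snd h)) \<circ>
              (\<lambda>h. (fst h, (snd h - Gx x ?z * fst h) / Gz x ?z)) = id"
        using nz[OF in_S] by (auto simp: fun_eq_iff)
    qed
    then have "(g has_derivative (\<lambda>h. (fst h, (snd h - Gx x ?z * fst h) / Gz x ?z))) (at (x, 0))"
      using f_eq by simp
    moreover have "((\<lambda>x. (x, 0)) has_derivative (\<lambda>h. (h, 0))) (at x)"
      by (auto intro!: derivative_eq_intros)
    ultimately have "(g \<circ> (\<lambda>x. (x, 0)) has_derivative
        (\<lambda>h. (fst h, (snd h - Gx x ?z * fst h) / Gz x ?z)) \<circ> (\<lambda>h. (h, 0))) (at x)"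
      by (intro diff_chain_at)
    from has_derivative_snd[OF this]
    have "(\<zeta> has_derivative (\<lambda>h. (0 - Gx x ?z * h) / Gz x ?z)) (at x)"
      by (simp add: \<zeta>_def o_def)
    moreover have "(\<lambda>h. (0 - Gx x ?z * h) / Gz x ?z) = (*) (- Gx x ?z / Gz x ?z)"
      by auto
    ultimately show ?thesis
      by (simp add: has_field_derivative_def)
  qed
  have cont\<zeta>: "continuous_on {-\<delta><..<\<delta>} \<zeta>"
    by (intro continuous_at_imp_continuous_on ballI DERIV_isCont[OF der\<zeta>]) (simp add: abs_less_iff)
  have "continuous_on {-\<delta><..<\<delta>} (\<lambda>x. - Gx x (\<zeta> x) / Gz x (\<zeta> x))"
  proof -
    have 1: "continuous_on {-\<delta><..<\<delta>} (\<lambda>x. (x, \<zeta> x))"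
      by (intro continuous_intros cont\<zeta>)
    have "Gz x (\<zeta> x) \<noteq> 0" if "x \<in> {-\<delta><..<\<delta>}" for x
      using nz gS[of x] that by auto
    then show ?thesis
      using continuous_on_compose2[OF contx 1] continuous_on_compose2[OF contz 1]
      by (intro continuous_intros) auto
  qed
  then have "\<zeta> C1_differentiable_on {-\<delta><..<\<delta>}"
    using der\<zeta> unfolding C1_differentiable_on_def has_real_derivative_iff_has_vector_derivative
    by (intro exI[of _ "\<lambda>x. - Gx x (\<zeta> x) / Gz x (\<zeta> x)"] conjI ballI) (simp_all add: abs_less_iff)
  moreover have "\<zeta> 0 = a"
  proof -
    have "g (f (0, a)) = (0, a)"
      using inj S(3) by (simp add: g_def)
    then show ?thesis
      using root by (simp add: f_def \<zeta>_def)
  qed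
  ultimately show ?thesis
    using that \<delta>(1) gS by blast
qed

text \<open>
  The implicit function theorem for a polynomial in \<open>\<epsilon>\<close> and \<open>z\<close>. A sum of products of one-variable
  polynomials has explicit partial derivatives.
\<close>

lemma simple_root_C1:
  fixes A B :: "'i \<Rightarrow> real poly"
  assumes root: "(\<Sum>i\<in>F. poly (A i) 0 * poly (B i) z0) = 0"
    and simple: "(\<Sum>i\<in>F. poly (A i) 0 * poly (pderiv (B i)) z0) \<noteq> 0"
  obtains \<delta> \<zeta> where "\<delta> > 0" "\<zeta> C1_differentiable_on {-\<delta><..<\<delta>}" "\<zeta> 0 = z0"
    "\<And>\<epsilon>. \<bar>\<epsilon>\<bar> < \<delta> \<Longrightarrow> (\<Sum>i\<in>F. poly (A i) \<epsilon> * poly (B i) (\<zeta> \<epsilon>)) = 0"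
proof (rule implicit_function_C1[where a = z0
      and G = "\<lambda>\<epsilon> z. \<Sum>i\<in>F. poly (A i) \<epsilon> * poly (B i) z"
      and Gx = "\<lambda>\<epsilon> z. \<Sum>i\<in>F. poly (pderiv (A i)) \<epsilon> * poly (B i) z"
      and Gz = "\<lambda>\<epsilon> z. \<Sum>i\<in>F. poly (A i) \<epsilon> * poly (pderiv (B i)) z"])
  fix \<epsilon> z :: real
  have "((\<lambda>p. poly (A i) (fst p) * poly (B i) (snd p)) has_derivative
      (\<lambda>h. poly (A i) \<epsilon> * (snd h * poly (pderiv (B i)) z) + fst h * poly (pderiv (A i)) \<epsilon> * poly (B i) z))
      (at (\<epsilon>, z))" for i
    using has_derivative_mult[OF
        DERIV_compose_FDERIV[where x = "(\<epsilon>, z)" and s = UNIV and g = fst and g' = fst, OF poly_DERIV]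
        DERIV_compose_FDERIV[where x = "(\<epsilon>, z)" and s = UNIV and g = snd and g' = snd, OF poly_DERIV]]
    by (simp add: has_derivative_fst has_derivative_snd)
  then have "((\<lambda>p. \<Sum>i\<in>F. poly (A i) (fst p) * poly (B i) (snd p)) has_derivative
      (\<lambda>h. \<Sum>i\<in>F. poly (A i) \<epsilon> * (snd h * poly (pderiv (B i)) z) + fst h * poly (pderiv (A i)) \<epsilon> * poly (B i) z))
      (at (\<epsilon>, z))"
    by (rule has_derivative_sum)
  then show "((\<lambda>p. \<Sum>i\<in>F. poly (A i) (fst p) * poly (B i) (snd p)) has_derivative
      (\<lambda>h. (\<Sum>i\<in>F. poly (pderiv (A i)) \<epsilon> * poly (B i) z) * fst h
         + (\<Sum>i\<in>F. poly (A i) \<epsilon> * poly (pderiv (B i)) z) * snd h)) (at (\<epsilon>, z))"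
    by (rule has_derivative_eq_rhs) (simp add: sum_distrib_left sum.distrib fun_eq_iff mult_ac)
qed (use root simple that in \<open>auto intro!: continuous_intros\<close>)

section \<open>Heine's formula for orthogonal polynomials of a discrete measure\<close>

definition node_poly :: "('a \<Rightarrow> real) \<Rightarrow> 'a set \<Rightarrow> real poly" where
  "node_poly x S = (\<Prod>s\<in>S. [:- x s, 1:])"

lemma poly_node_poly: "poly (node_poly x S) t = (\<Prod>s\<in>S. t - x s)"
  by (simp add: node_poly_def poly_prod)

lemma degree_node_poly: "finite S \<Longrightarrow> degree (node_poly x S) = card S"
  by (simp add: node_poly_def degree_prod_sum_eq)

lemma lead_coeff_node_poly: "coeff (node_poly x S) (card S) = 1"
proof (cases "finite S")
  case True
  then have "coeff (node_poly x S) (card S) = lead_coeff (node_poly x S)"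
    by (simp add: degree_node_poly)
  then show ?thesis
    by (simp add: node_poly_def lead_coeff_prod)
qed (simp add: node_poly_def)

text \<open>
  The sum is the divided difference of \<open>f\<close> at the points \<open>x i\<close>, that is, the coefficient of degree
  \<open>card U - 1\<close> in the interpolation polynomial of \<open>f\<close>. This polynomial is \<open>f\<close> itself, of lower degree.
\<close>

lemma divided_difference_eq_0:
  fixes x :: "'a \<Rightarrow> real"
  assumes "finite U" "inj_on x U" and deg: "Suc (degree f) < card U"
  shows "(\<Sum>i\<in>U. poly f (x i) / (\<Prod>s\<in>U - {i}. x i - x s)) = 0"
proof -
  define n where "n = card U - 1"
  let ?c = "\<lambda>i. poly f (x i) / (\<Prod>s\<in>U - {i}. x i - x s)"
  \<comment> \<open>The interpolation polynomial of \<open>f\<close> in Lagrange's form.\<close>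
  define h where "h = (\<Sum>i\<in>U. smult (?c i) (node_poly x (U - {i})))"
  have card: "card (U - {i}) = n" if "i \<in> U" for i
    using that assms(1) by (simp add: n_def)
  have "poly h (x j) = poly f (x j)" if j: "j \<in> U" for j
  proof -
    have "poly h (x j) = (\<Sum>i\<in>U. ?c i * (\<Prod>s\<in>U - {i}. x j - x s))"
      by (simp add: h_def poly_sum poly_node_poly)
    also have "\<dots> = (\<Sum>i\<in>U. if i = j then ?c i * (\<Prod>s\<in>U - {i}. x j - x s) else 0)"
      using j assms(1) by (intro sum.cong refl) (auto intro!: prod_zero)
    also have "\<dots> = ?c j * (\<Prod>s\<in>U - {j}. x j - x s)"
      using j assms(1) by simp
    also have "\<dots> = poly f (x j)"
      using j assms(1,2) by (auto simp: inj_on_eq_iff)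
    finally show ?thesis .
  qed
  moreover have "degree h \<le> n"
    unfolding h_def using card assms(1)
    by (intro degree_sum_le) (auto intro!: order.trans[OF degree_smult_le] simp: degree_node_poly)
  moreover have "card (x ` U) = Suc n"
    using assms deg by (simp add: card_image n_def)
  ultimately have "h = f"
    using deg by (intro poly_eqI_degree[of "x ` U"]) (auto simp: n_def)
  moreover have "coeff h n = (\<Sum>i\<in>U. ?c i)"
  proof -
    have "coeff (node_poly x (U - {i})) n = 1" if "i \<in> U" for i
      using lead_coeff_node_poly[of x "U - {i}"] card[OF that] by simp
    then show ?thesis
      by (simp add: h_def coeff_sum)
  qed
  ultimately show ?thesis
    using deg coeff_eq_0[of f n] by (simp add: n_def)
qed

text \<open>
  Up to a sign that depends only on \<open>card S\<close>, the square of the Vandermonde determinant of the points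
  \<open>x s\<close>. With this sign no ordering of the index set enters.
\<close>

definition node_discriminant :: "('a \<Rightarrow> real) \<Rightarrow> 'a set \<Rightarrow> real" where
  "node_discriminant x S = (\<Prod>s\<in>S. \<Prod>r\<in>S - {s}. x s - x r)"

lemma node_discriminant_nonzero:
  "finite S \<Longrightarrow> inj_on x S \<Longrightarrow> node_discriminant x S \<noteq> 0"
  by (auto simp: node_discriminant_def inj_on_eq_iff)

lemma node_discriminant_insert:
  assumes "finite S" "i \<notin> S"
  shows "node_discriminant x (insert i S) =
           (- 1) ^ card S * (\<Prod>s\<in>S. x i - x s)\<^sup>2 * node_discriminant x S"
proof -
  have "(\<Prod>r\<in>insert i S - {s}. x s - x r) = (x s - x i) * (\<Prod>r\<in>S - {s}. x s - x r)"
    if "s \<in> S" for s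
  proof -
    have "insert i S - {s} = insert i (S - {s})"
      using that assms(2) by auto
    then show ?thesis
      using assms by simp
  qed
  then have "node_discriminant x (insert i S) =
      (\<Prod>s\<in>S. x i - x s) * ((\<Prod>s\<in>S. x s - x i) * node_discriminant x S)"
    using assms by (simp add: node_discriminant_def prod.distrib cong: prod.cong)
  moreover have "(\<Prod>s\<in>S. x s - x i) = (- 1) ^ card S * (\<Prod>s\<in>S. x i - x s)"
    using prod.distrib[of "\<lambda>_. - 1" "\<lambda>s. x i - x s" S] by (simp add: prod_constant)
  ultimately show ?thesis
    by (simp add: power2_eq_square)
qed

text \<open>
  Heine's formula for the orthogonal polynomial of degree \<open>N\<close> of the measure with weight \<open>w i\<close> at \<open>x i\<close>:
  up to normalization, and formally when weights are negative, the expectation of \<open>\<Prod>\<^sub>s (t - x s)\<close> over \<open>N\<close> random points whose joint density is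
  the product of the weights and of the squared Vandermonde determinant. The unnormalized form is kept
  because it is polynomial in the weights.
\<close>

definition heine_poly :: "'a set \<Rightarrow> ('a \<Rightarrow> real) \<Rightarrow> ('a \<Rightarrow> real) \<Rightarrow> nat \<Rightarrow> real poly" where
  "heine_poly I x w N =
     (\<Sum>S | S \<subseteq> I \<and> card S = N. smult ((\<Prod>s\<in>S. w s) * node_discriminant x S) (node_poly x S))"

lemma degree_heine_poly:
  assumes "finite I"
  shows "degree (heine_poly I x w N) \<le> N"
  unfolding heine_poly_def using assms
  by (intro degree_sum_le)
     (auto intro!: order.trans[OF degree_smult_le] simp: degree_node_poly finite_subset)

lemma coeff_heine_poly:
  "coeff (heine_poly I x w N) N =
     (\<Sum>S | S \<subseteq> I \<and> card S = N. (\<Prod>s\<in>S. w s) * node_discriminant x S)"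
  unfolding heine_poly_def coeff_sum
  by (intro sum.cong refl) (auto simp: lead_coeff_node_poly)

text \<open>
  A pair of an \<open>N\<close>-set \<open>S\<close> and an evaluation point \<open>i\<close> contributes only if \<open>i\<close> lies outside \<open>S\<close>, and is
  then the same as the \<open>(N+1)\<close>-set \<open>U = insert i S\<close> with a marked element. Since passing from \<open>S\<close> to \<open>U\<close>
  multiplies the discriminant by \<open>\<plusminus> (\<Prod>s\<in>S. x i - x s)\<^sup>2\<close>, the contributions to a fixed \<open>U\<close> add up to a
  multiple of a divided difference of \<open>f\<close> at \<open>N + 1\<close> points, which vanishes.
\<close>

lemma heine_poly_orthogonal:
  assumes fin: "finite I" and inj: "inj_on x I" and deg: "degree f < N"
  shows "(\<Sum>i\<in>I. w i * (poly (heine_poly I x w N) (x i) * poly f (x i))) = 0"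
proof -
  let ?W = "\<lambda>S. \<Prod>s\<in>S. w s"
  let ?D = "node_discriminant x"
  let ?P = "\<lambda>S i. \<Prod>s\<in>S. x i - x s"
  let ?N = "{S. S \<subseteq> I \<and> card S = N}" and ?M = "{U. U \<subseteq> I \<and> card U = Suc N}"
  have finN: "finite ?N" and finM: "finite ?M"
    using fin by auto
  have finS: "finite S" if "S \<subseteq> I" for S
    using fin that finite_subset by blast
  have "(\<Sum>i\<in>I. w i * (poly (heine_poly I x w N) (x i) * poly f (x i))) =
      (\<Sum>S\<in>?N. \<Sum>i\<in>I. w i * ?W S * ?D S * ?P S i * poly f (x i))"
    by (subst sum.swap) (simp add: heine_poly_def poly_sum poly_node_poly sum_distrib_left
        sum_distrib_right mult_ac)
  \<comment> \<open>\<open>node_poly x S\<close> vanishes at the points of \<open>S\<close>.\<close>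
  also have "\<dots> = (\<Sum>S\<in>?N. \<Sum>i\<in>I - S. w i * ?W S * ?D S * ?P S i * poly f (x i))"
    using fin finS by (intro sum.cong refl sum.mono_neutral_right) (auto intro!: prod_zero)
  also have "\<dots> = (\<Sum>(S, i)\<in>(SIGMA S:?N. I - S). w i * ?W S * ?D S * ?P S i * poly f (x i))"
    using fin by (intro sum.Sigma finN) auto
  \<comment> \<open>Reindex by \<open>U = insert i S\<close>; the only case with content is the equality of the summands.\<close>
  also have "\<dots> = (\<Sum>(U, i)\<in>(SIGMA U:?M. U).
      ?W U * ((- 1) ^ N * ?D U) * (poly f (x i) / ?P (U - {i}) i))"
  proof (rule sum.reindex_bij_witness[where j = "\<lambda>(S, i). (insert i S, i)" and i = "\<lambda>(U, i). (U - {i}, i)"],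
      goal_cases)
    case (5 a)
    then obtain S i where a: "a = (S, i)" "S \<subseteq> I" "card S = N" "i \<in> I" "i \<notin> S"
      by auto
    have P: "?P S i \<noteq> 0"
      using a inj finS[OF a(2)] by (auto simp: inj_on_eq_iff subset_iff)
    have D: "(- 1) ^ N * ?D (insert i S) = (?P S i)\<^sup>2 * ?D S"
      using a finS[OF a(2)]
      by (simp add: node_discriminant_insert mult.assoc[symmetric] power_mult_distrib[symmetric])
    have "?W (insert i S) * ((- 1) ^ N * ?D (insert i S)) * (poly f (x i) / ?P (insert i S - {i}) i)
        = w i * ?W S * ((?P S i)\<^sup>2 * ?D S) * (poly f (x i) / ?P S i)"
      unfolding D using a finS[OF a(2)] by simp
    also have "\<dots> = w i * ?W S * ?D S * ?P S i * poly f (x i)"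
      using P by (simp add: power2_eq_square)
    finally show ?case
      by (simp add: a(1))
  qed (use finS in \<open>auto simp: insert_absorb card_insert_if card_Diff_singleton_if\<close>)
  also have "\<dots> = (\<Sum>U\<in>?M. \<Sum>i\<in>U. ?W U * ((- 1) ^ N * ?D U) * (poly f (x i) / ?P (U - {i}) i))"
    using finS by (intro sum.Sigma[symmetric] finM) auto
  also have "\<dots> = (\<Sum>U\<in>?M. ?W U * ((- 1) ^ N * ?D U) * (\<Sum>i\<in>U. poly f (x i) / ?P (U - {i}) i))"
    by (simp add: sum_distrib_left)
  also have "\<dots> = 0"
  proof (rule sum.neutral, safe)
    fix U assume U: "U \<subseteq> I" "card U = Suc N"
    have "(\<Sum>i\<in>U. poly f (x i) / ?P (U - {i}) i) = 0"
      by (rule divided_difference_eq_0) (use U finS deg inj inj_on_subset in auto)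
    then show "?W U * ((- 1) ^ N * ?D U) * (\<Sum>i\<in>U. poly f (x i) / ?P (U - {i}) i) = 0"
      by simp
  qed
  finally show ?thesis .
qed

section \<open>Lagrange interpolation and Gauss quadrature\<close>

definition lagrange_poly :: "(nat \<Rightarrow> real) \<Rightarrow> nat \<Rightarrow> nat \<Rightarrow> real poly" where
  "lagrange_poly \<phi> N n = (\<Prod>j\<in>{1..N} - {n}. smult (1 / (\<phi> n - \<phi> j)) [:- \<phi> j, 1:])"

lemma poly_lagrange_poly: "poly (lagrange_poly \<phi> N n) = lagrange_basis \<phi> N n"
  by (simp add: fun_eq_iff lagrange_poly_def lagrange_basis_def poly_prod diff_divide_distrib)

lemma degree_lagrange_poly:
  assumes "n \<in> {1..N}"
  shows "degree (lagrange_poly \<phi> N n) < N"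
proof -
  have "degree (lagrange_poly \<phi> N n) \<le> (\<Sum>j\<in>{1..N} - {n}. degree (smult (1 / (\<phi> n - \<phi> j)) [:- \<phi> j, 1:]))"
    unfolding lagrange_poly_def by (rule order.trans[OF degree_prod_sum_le]) (simp_all add: o_def)
  also have "\<dots> \<le> (\<Sum>j\<in>{1..N} - {n}. 1)"
    by (intro sum_mono) (auto intro: order.trans[OF degree_smult_le])
  also have "\<dots> < N"
    using assms by simp
  finally show ?thesis .
qed

lemma lagrange_basis_node:
  assumes "inj_on \<phi> {1..N}" "n \<in> {1..N}" "j \<in> {1..N}"
  shows "lagrange_basis \<phi> N n (\<phi> j) = (if j = n then 1 else 0)"
proof (cases "j = n")
  case True
  then show ?thesis
    using assms by (auto simp: lagrange_basis_def inj_on_eq_iff intro!: prod.neutral)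
next
  case False
  then show ?thesis
    using assms by (auto simp: lagrange_basis_def intro!: prod_zero bexI[of _ j])
qed

lemma lagrange_interpolation:
  assumes "inj_on \<phi> {1..N}" "degree r < N"
  shows "r = (\<Sum>n=1..N. smult (poly r (\<phi> n)) (lagrange_poly \<phi> N n))"
proof (rule poly_eqI_degree[of "\<phi> ` {1..N}"])
  have card: "card (\<phi> ` {1..N}) = N"
    using assms(1) by (simp add: card_image)
  show "degree r < card (\<phi> ` {1..N})"
    using card assms(2) by simp
  have "degree (\<Sum>n=1..N. smult (poly r (\<phi> n)) (lagrange_poly \<phi> N n)) \<le> N - 1"
    using degree_lagrange_poly[of _ N \<phi>]
    by (intro degree_sum_le) (force intro!: order.trans[OF degree_smult_le])+
  then show "degree (\<Sum>n=1..N. smult (poly r (\<phi> n)) (lagrange_poly \<phi> N n)) < card (\<phi> ` {1..N})"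
    using card assms(2) by simp
  fix z assume "z \<in> \<phi> ` {1..N}"
  then obtain j where j: "z = \<phi> j" "j \<in> {1..N}"
    by blast
  have "poly (\<Sum>n=1..N. smult (poly r (\<phi> n)) (lagrange_poly \<phi> N n)) z =
      (\<Sum>n=1..N. if n = j then poly r (\<phi> n) else 0)"
    unfolding poly_sum by (intro sum.cong refl) (use j assms(1) in \<open>simp add: poly_lagrange_poly lagrange_basis_node\<close>)
  then show "poly r z = poly (\<Sum>n=1..N. smult (poly r (\<phi> n)) (lagrange_poly \<phi> N n)) z"
    using j by simp
qed

text \<open>
  Division by \<open>Q\<close> writes \<open>f = Q g + r\<close> with \<open>g\<close> and \<open>r\<close> of degree below \<open>N\<close>. The part \<open>Q g\<close> has integral
  zero by orthogonality and vanishes at the roots of \<open>Q\<close>, while the interpolatory rule is exact for \<open>r\<close>.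
\<close>

lemma gauss_quadrature:
  fixes x :: "'a \<Rightarrow> real"
  assumes deg: "degree Q \<le> N" and lead: "coeff Q N \<noteq> 0"
    and orth: "\<And>g. degree g < N \<Longrightarrow> (\<Sum>i\<in>I. w i * (poly Q (x i) * poly g (x i))) = 0"
    and inj: "inj_on z {1..N}" and root: "\<And>n. n \<in> {1..N} \<Longrightarrow> poly Q (z n) = 0"
    and degf: "degree f < 2 * N"
  shows "(\<Sum>i\<in>I. w i * poly f (x i)) =
         (\<Sum>n=1..N. (\<Sum>i\<in>I. w i * lagrange_basis z N n (x i)) * poly f (z n))"
proof -
  have N: "N > 0" and Q: "Q \<noteq> 0" "degree Q = N"
    using degf lead deg le_degree[OF lead] by auto
  define g r where "g = f div Q" and "r = f mod Q"
  have f: "f = Q * g + r"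
    by (simp add: g_def r_def)
  have r: "degree r < N"
    using degree_mod_less[OF Q(1), of f] Q(2) N by (auto simp: r_def)
  have g: "degree g < N"
  proof (cases "g = 0")
    case False
    then have "degree (Q * g) = N + degree g"
      using Q by (simp add: degree_mult_eq)
    then have "degree f = N + degree g"
      using r by (simp add: f degree_add_eq_left)
    then show ?thesis
      using degf by simp
  qed (use N in simp)
  have f_eq: "poly f (z n) = poly r (z n)" if "n \<in> {1..N}" for n
    using root[OF that] by (simp add: f)
  have interp: "poly r t = (\<Sum>n=1..N. poly r (z n) * lagrange_basis z N n t)" for t
    using arg_cong[OF lagrange_interpolation[OF inj r], of "\<lambda>p. poly p t"]
    by (simp add: poly_sum poly_lagrange_poly)
  have r_eq: "poly r t = (\<Sum>n=1..N. poly f (z n) * lagrange_basis z N n t)" for t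
    by (subst interp, intro sum.cong refl) (simp only: f_eq)
  have "(\<Sum>i\<in>I. w i * poly f (x i)) =
      (\<Sum>i\<in>I. w i * (poly Q (x i) * poly g (x i))) + (\<Sum>i\<in>I. w i * poly r (x i))"
    by (simp add: f ring_distribs sum.distrib)
  also have "\<dots> = (\<Sum>i\<in>I. \<Sum>n=1..N. w i * (poly f (z n) * lagrange_basis z N n (x i)))"
    using orth[OF g] by (simp add: r_eq sum_distrib_left)
  also have "\<dots> = (\<Sum>n=1..N. (\<Sum>i\<in>I. w i * lagrange_basis z N n (x i)) * poly f (z n))"
    by (subst sum.swap) (simp add: sum_distrib_left mult_ac)
  finally show ?thesis .
qed

section \<open>The quadrature rule of a perturbed measure\<close>

definition perturbed_weight :: "nat \<Rightarrow> (nat \<Rightarrow> real) \<Rightarrow> real \<Rightarrow> nat \<Rightarrow> real" where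
  "perturbed_weight N y \<epsilon> i = (if i \<le> N then y i else \<epsilon> * y i)"

lemma sum_perturbed_weight:
  "(\<Sum>i=1..N+M. perturbed_weight N y \<epsilon> i * g i) =
     (\<Sum>i=1..N. y i * g i) + \<epsilon> * (\<Sum>i=N+1..N+M. y i * g i)"
proof -
  have "(\<Sum>i=1..N+M. perturbed_weight N y \<epsilon> i * g i) =
      (\<Sum>i=1..N. perturbed_weight N y \<epsilon> i * g i) + (\<Sum>i=N+1..N+M. perturbed_weight N y \<epsilon> i * g i)"
    using sum.ub_add_nat[of 1 N "\<lambda>i. perturbed_weight N y \<epsilon> i * g i" M] by simp
  then show ?thesis
    by (simp add: perturbed_weight_def sum_distrib_left mult_ac)
qed

text \<open>
  At \<open>\<epsilon> = 0\<close> only \<open>S = {1..N}\<close> survives in Heine's formula: any other \<open>N\<close>-set contains an index above \<open>N\<close>,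
  whose weight is zero.
\<close>

lemma heine_poly_unperturbed:
  "heine_poly {1..N+M} x (perturbed_weight N y 0) N =
     smult ((\<Prod>n=1..N. y n) * node_discriminant x {1..N}) (node_poly x {1..N})"
proof -
  have "heine_poly {1..N+M} x (perturbed_weight N y 0) N =
     (\<Sum>S\<in>{{1..N}}. smult ((\<Prod>s\<in>S. perturbed_weight N y 0 s) * node_discriminant x S) (node_poly x S))"
    unfolding heine_poly_def
  proof (intro sum.mono_neutral_right ballI)
    fix S assume "S \<in> {S. S \<subseteq> {1..N+M} \<and> card S = N} - {{1..N}}"
    then have S: "S \<subseteq> {1..N+M}" "card S = N" "S \<noteq> {1..N}" by auto
    then have "finite S"
      by (meson finite_subset finite_atLeastAtMost)
    have "\<not> S \<subseteq> {1..N}"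
      using S card_subset_eq[of "{1..N}" S] by auto
    then obtain s where "s \<in> S" "s \<notin> {1..N}"
      by blast
    then have "s \<in> S" "perturbed_weight N y 0 s = 0"
      using S(1) by (auto simp: perturbed_weight_def)
    then have "\<exists>s\<in>S. perturbed_weight N y 0 s = 0"
      by blast
    then show "smult ((\<Prod>s\<in>S. perturbed_weight N y 0 s) * node_discriminant x S) (node_poly x S) = 0"
      using \<open>finite S\<close> by simp
  qed auto
  then show ?thesis
    by (simp add: perturbed_weight_def)
qed

text \<open>
  At \<open>\<epsilon> = 0\<close> the derivative of the polynomial at \<open>x n\<close> is a nonzero multiple of the product of the
  differences \<open>x n - x j\<close>, so that the root is simple.
\<close>

lemma heine_poly_root_branch:
  assumes inj: "inj_on x {1..N+M}" and nz: "\<And>n. n \<in> {1..N} \<Longrightarrow> y n \<noteq> 0" and n: "n \<in> {1..N}"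
  obtains \<delta> \<zeta> where "\<delta> > 0" "\<zeta> C1_differentiable_on {-\<delta><..<\<delta>}" "\<zeta> 0 = x n"
    "\<And>\<epsilon>. \<bar>\<epsilon>\<bar> < \<delta> \<Longrightarrow> poly (heine_poly {1..N+M} x (perturbed_weight N y \<epsilon>) N) (\<zeta> \<epsilon>) = 0"
proof -
  define F where "F = {S. S \<subseteq> {1..N+M} \<and> card S = N}"
  \<comment> \<open>\<open>A S\<close> collects the dependence on \<open>\<epsilon>\<close> of the term of \<open>S\<close> in Heine's formula, and \<open>B S\<close> the dependence on the variable.\<close>
  define A where "A = (\<lambda>S. \<Prod>s\<in>S. if s \<le> N then [:y s:] else [:0, y s:])"
  define B where "B = (\<lambda>S. smult (node_discriminant x S) (node_poly x S))"
  define c where "c = (\<Prod>n=1..N. y n) * node_discriminant x {1..N}"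
  let ?Q = "\<lambda>\<epsilon>. heine_poly {1..N+M} x (perturbed_weight N y \<epsilon>) N"
  have A: "poly (A S) \<epsilon> = (\<Prod>s\<in>S. perturbed_weight N y \<epsilon> s)" for S \<epsilon>
    unfolding A_def poly_prod by (intro prod.cong refl) (auto simp: perturbed_weight_def)
  have Q: "?Q \<epsilon> = (\<Sum>S\<in>F. smult (poly (A S) \<epsilon>) (B S))" for \<epsilon>
    by (simp add: heine_poly_def F_def A B_def)
  have Q0: "?Q 0 = smult c (node_poly x {1..N})"
    unfolding c_def by (rule heine_poly_unperturbed)
  have c: "c \<noteq> 0"
    using nz node_discriminant_nonzero[of "{1..N}" x] inj_on_subset[OF inj, of "{1..N}"]
    by (simp add: c_def)
  have split: "node_poly x {1..N} = [:- x n, 1:] * node_poly x ({1..N} - {n})"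
    using n by (simp add: node_poly_def prod.remove del: mult_pCons_left)
  have "poly (?Q 0) (x n) = 0"
    unfolding Q0 split by simp
  then have root: "(\<Sum>S\<in>F. poly (A S) 0 * poly (B S) (x n)) = 0"
    unfolding Q by (simp add: poly_sum)
  have "poly (pderiv (?Q 0)) (x n) = c * (\<Prod>j\<in>{1..N} - {n}. x n - x j)"
    unfolding Q0 split pderiv_smult pderiv_mult by (simp add: poly_node_poly pderiv_pCons)
  moreover have "(\<Prod>j\<in>{1..N} - {n}. x n - x j) \<noteq> 0"
    using n inj by (auto simp: inj_on_eq_iff)
  moreover have "pderiv (?Q 0) = (\<Sum>S\<in>F. smult (poly (A S) 0) (pderiv (B S)))"
    unfolding Q by (induction F rule: infinite_finite_induct) (simp_all add: pderiv_add pderiv_smult)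
  ultimately have simple: "(\<Sum>S\<in>F. poly (A S) 0 * poly (pderiv (B S)) (x n)) \<noteq> 0"
    using c by (simp add: poly_sum)
  show ?thesis
  proof (rule simple_root_C1[OF root simple])
    fix \<delta> \<zeta>
    assume "\<delta> > 0" "\<zeta> C1_differentiable_on {-\<delta><..<\<delta>}" "\<zeta> 0 = x n"
      and "\<And>\<epsilon>. \<bar>\<epsilon>\<bar> < \<delta> \<Longrightarrow> (\<Sum>S\<in>F. poly (A S) \<epsilon> * poly (B S) (\<zeta> \<epsilon>)) = 0"
    then show ?thesis
      by (intro that[of \<delta> \<zeta>]) (simp_all only: Q poly_sum poly_smult)
  qed
qed

lemma C1_perturbed_weight: "(\<lambda>\<epsilon>. perturbed_weight N y \<epsilon> i) C1_differentiable_on S"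
  by (cases "i \<le> N") (simp_all add: perturbed_weight_def)

text \<open>
  The root branches become the points of the rule, and the integrals of the Lagrange basis at
  these points its weights. The interval is shrunk so that the points stay positive and in
  their original order, the orthogonal polynomial keeps degree \<open>N\<close>, and the weights stay nonzero: all
  of these hold at \<open>\<epsilon> = 0\<close> and are open conditions.
\<close>

lemma perturbed_quadrature:
  fixes x y :: "nat \<Rightarrow> real"
  assumes dec: "\<And>i j. 1 \<le> i \<Longrightarrow> i < j \<Longrightarrow> x j < x i" and pos: "\<And>i. x i > 0"
    and nz: "\<And>n. n \<in> {1..N} \<Longrightarrow> y n \<noteq> 0"
  obtains \<delta> v z where "\<delta> > 0"
    "\<And>n. n \<in> {1..N} \<Longrightarrow> v n C1_differentiable_on {-\<delta><..<\<delta>}"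
    "\<And>n. n \<in> {1..N} \<Longrightarrow> z n C1_differentiable_on {-\<delta><..<\<delta>}"
    "\<And>n. n \<in> {1..N} \<Longrightarrow> v n 0 = y n"
    "\<And>n. n \<in> {1..N} \<Longrightarrow> z n 0 = x n"
    "\<And>n \<epsilon>. n \<in> {1..N} \<Longrightarrow> \<bar>\<epsilon>\<bar> < \<delta> \<Longrightarrow> v n \<epsilon> \<noteq> 0 \<and> z n \<epsilon> > 0"
    "\<And>i j \<epsilon>. i \<in> {1..N} \<Longrightarrow> j \<in> {1..N} \<Longrightarrow> i < j \<Longrightarrow> \<bar>\<epsilon>\<bar> < \<delta> \<Longrightarrow> z j \<epsilon> < z i \<epsilon>"
    "\<And>f \<epsilon>. degree f < 2 * N \<Longrightarrow> \<bar>\<epsilon>\<bar> < \<delta> \<Longrightarrow>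
       (\<Sum>n=1..N. v n \<epsilon> * poly f (z n \<epsilon>)) =
       (\<Sum>i=1..N+M. perturbed_weight N y \<epsilon> i * poly f (x i))"
proof -
  let ?I = "{1..N+M}"
  let ?Q = "\<lambda>\<epsilon>. heine_poly ?I x (perturbed_weight N y \<epsilon>) N"
  have injI: "inj_on x ?I"
    by (intro linorder_inj_onI) (use dec in \<open>force+\<close>)
  have inj: "inj_on x {1..N}"
    by (rule inj_on_subset[OF injI]) auto
  have "\<exists>d \<zeta>. d > 0 \<and> \<zeta> C1_differentiable_on {-d<..<d} \<and> \<zeta> 0 = x n \<and>
          (\<forall>\<epsilon>. \<bar>\<epsilon>\<bar> < d \<longrightarrow> poly (?Q \<epsilon>) (\<zeta> \<epsilon>) = 0)" if "n \<in> {1..N}" for n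
    by (rule heine_poly_root_branch[OF injI nz that]) blast+
  then obtain d z where dz: "\<And>n. n \<in> {1..N} \<Longrightarrow> d n > 0 \<and> z n C1_differentiable_on {-d n<..<d n} \<and>
      z n 0 = x n \<and> (\<forall>\<epsilon>. \<bar>\<epsilon>\<bar> < d n \<longrightarrow> poly (?Q \<epsilon>) (z n \<epsilon>) = 0)"
    by metis
  \<comment> \<open>The element 1 gives the minimum a meaning for \<open>N = 0\<close>.\<close>
  define \<delta>1 where "\<delta>1 = Min (insert 1 (d ` {1..N}))"
  have \<delta>1: "\<delta>1 > 0" "\<And>n. n \<in> {1..N} \<Longrightarrow> \<delta>1 \<le> d n"
    unfolding \<delta>1_def using dz by (auto intro!: Min_le simp del: Min_insert)
  have z_C1: "z n C1_differentiable_on {-\<delta>1<..<\<delta>1}" if "n \<in> {1..N}" for n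
    using dz[OF that] \<delta>1(2)[OF that] by (auto intro: C1_differentiable_on_subset)
  have z0: "z n 0 = x n" if "n \<in> {1..N}" for n
    using dz[OF that] by blast
  have z_pos: "\<forall>\<^sub>F \<epsilon> in nhds 0. \<forall>n\<in>{1..N}. 0 < z n \<epsilon>"
    by (intro eventually_ball_finite ballI eventually_order_C1[where \<delta> = \<delta>1 and f = "\<lambda>_. 0"])
       (use z_C1 \<delta>1 z0 pos in auto)
  have z_dec: "\<forall>\<^sub>F \<epsilon> in nhds 0. \<forall>i\<in>{1..N}. \<forall>j\<in>{1..N}. i < j \<longrightarrow> z j \<epsilon> < z i \<epsilon>"
  proof (intro eventually_ball_finite ballI)
    fix i j assume ij: "i \<in> {1..N}" "j \<in> {1..N}"
    show "\<forall>\<^sub>F \<epsilon> in nhds 0. i < j \<longrightarrow> z j \<epsilon> < z i \<epsilon>"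
    proof (cases "i < j")
      case True
      have "\<forall>\<^sub>F \<epsilon> in nhds 0. z j \<epsilon> < z i \<epsilon>"
        by (rule eventually_order_C1[of _ \<delta>1]) (use z_C1 \<delta>1 z0 dec ij True in auto)
      then show ?thesis
        by (rule eventually_mono) simp
    qed simp
  qed auto
  have lead: "\<forall>\<^sub>F \<epsilon> in nhds 0. coeff (?Q \<epsilon>) N \<noteq> 0"
  proof (rule eventually_nonzero_C1[of _ 1])
    show "(\<lambda>\<epsilon>. coeff (?Q \<epsilon>) N) C1_differentiable_on {-1<..<1}"
      unfolding coeff_heine_poly
      by (intro C1_differentiable_on_sum C1_differentiable_on_mult C1_differentiable_on_prod
          C1_perturbed_weight C1_differentiable_on_const)
    show "coeff (?Q 0) N \<noteq> 0"
      unfolding heine_poly_unperturbed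
      using lead_coeff_node_poly[of x "{1..N}"] nz node_discriminant_nonzero[OF _ inj] by simp
  qed simp
  obtain \<delta>2 where \<delta>2: "\<delta>2 > 0" and ev2: "\<And>\<epsilon>. \<bar>\<epsilon>\<bar> < \<delta>2 \<Longrightarrow> (\<forall>n\<in>{1..N}. 0 < z n \<epsilon>) \<and>
      (\<forall>i\<in>{1..N}. \<forall>j\<in>{1..N}. i < j \<longrightarrow> z j \<epsilon> < z i \<epsilon>) \<and> coeff (?Q \<epsilon>) N \<noteq> 0"
    using eventually_conj[OF z_pos eventually_conj[OF z_dec lead]]
    unfolding eventually_nhds_metric by (auto simp: dist_real_def)
  define \<delta>3 where "\<delta>3 = min \<delta>1 \<delta>2"
  have \<delta>3: "\<delta>3 > 0" "\<delta>3 \<le> \<delta>1" "\<delta>3 \<le> \<delta>2"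
    using \<delta>1 \<delta>2 by (auto simp: \<delta>3_def)
  have z_inj: "inj_on (\<lambda>n. z n \<epsilon>) {1..N}" if "\<bar>\<epsilon>\<bar> < \<delta>3" for \<epsilon>
    by (intro linorder_inj_onI) (use ev2[of \<epsilon>] that \<delta>3 in \<open>force+\<close>)
  define v where "v = (\<lambda>n \<epsilon>. \<Sum>i\<in>?I. perturbed_weight N y \<epsilon> i * lagrange_basis (\<lambda>k. z k \<epsilon>) N n (x i))"
  have z_C1': "z n C1_differentiable_on {-\<delta>3<..<\<delta>3}" if "n \<in> {1..N}" for n
    using z_C1[OF that] \<delta>3 by (auto intro: C1_differentiable_on_subset)
  have v_C1: "v n C1_differentiable_on {-\<delta>3<..<\<delta>3}" if n: "n \<in> {1..N}" for n
    unfolding v_def lagrange_basis_def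
  proof (intro C1_differentiable_on_sum C1_differentiable_on_mult C1_perturbed_weight
      C1_differentiable_on_prod C1_differentiable_on_divide C1_differentiable_on_diff
      C1_differentiable_on_const z_C1' n)
    fix j \<epsilon> assume "j \<in> {1..N} - {n}" "\<epsilon> \<in> {-\<delta>3<..<\<delta>3}"
    then show "z n \<epsilon> - z j \<epsilon> \<noteq> 0"
      using inj_onD[OF z_inj, of \<epsilon> n j] n by (auto simp: abs_less_iff)
  qed auto
  have v0: "v n 0 = y n" if n: "n \<in> {1..N}" for n
  proof -
    have "v n 0 = (\<Sum>i=1..N. y i * lagrange_basis (\<lambda>k. z k 0) N n (x i))"
      unfolding v_def by (subst sum_perturbed_weight) simp
    also have "\<dots> = (\<Sum>i=1..N. if i = n then y i else 0)"
    proof (intro sum.cong refl)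
      fix i assume i: "i \<in> {1..N}"
      have "lagrange_basis (\<lambda>k. z k 0) N n (x i) = (if i = n then 1 else 0)"
        using lagrange_basis_node[OF z_inj[of 0] n i] \<delta>3 z0[OF i] by simp
      then show "y i * lagrange_basis (\<lambda>k. z k 0) N n (x i) = (if i = n then y i else 0)"
        by simp
    qed
    finally show ?thesis
      using n by simp
  qed
  have "\<forall>\<^sub>F \<epsilon> in nhds 0. \<forall>n\<in>{1..N}. v n \<epsilon> \<noteq> 0"
    by (intro eventually_ball_finite ballI eventually_nonzero_C1[of _ \<delta>3])
       (use v_C1 \<delta>3 v0 nz in auto)
  then obtain \<delta>4 where \<delta>4: "\<delta>4 > 0" and ev4: "\<And>\<epsilon>. \<bar>\<epsilon>\<bar> < \<delta>4 \<Longrightarrow> \<forall>n\<in>{1..N}. v n \<epsilon> \<noteq> 0"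
    unfolding eventually_nhds_metric by (auto simp: dist_real_def)
  define \<delta> where "\<delta> = min \<delta>3 \<delta>4"
  have \<delta>: "\<delta> > 0" "\<delta> \<le> \<delta>3" "\<delta> \<le> \<delta>4"
    using \<delta>3 \<delta>4 by (auto simp: \<delta>_def)
  have quad: "(\<Sum>n=1..N. v n \<epsilon> * poly f (z n \<epsilon>)) =
       (\<Sum>i=1..N+M. perturbed_weight N y \<epsilon> i * poly f (x i))"
    if "degree f < 2 * N" "\<bar>\<epsilon>\<bar> < \<delta>" for f \<epsilon>
    unfolding v_def
  proof (rule gauss_quadrature[symmetric, of "?Q \<epsilon>"])
    show "degree (?Q \<epsilon>) \<le> N"
      by (simp add: degree_heine_poly)
    show "coeff (?Q \<epsilon>) N \<noteq> 0"
      using ev2[of \<epsilon>] that \<delta> \<delta>3 by auto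
    show "inj_on (\<lambda>k. z k \<epsilon>) {1..N}"
      using z_inj that \<delta> by simp
    show "poly (?Q \<epsilon>) (z n \<epsilon>) = 0" if "n \<in> {1..N}" for n
      using dz[OF that] \<delta>1(2)[OF that] \<open>\<bar>\<epsilon>\<bar> < \<delta>\<close> \<delta> \<delta>3 by simp
    show "(\<Sum>i=1..N+M. perturbed_weight N y \<epsilon> i * (poly (?Q \<epsilon>) (x i) * poly g (x i))) = 0"
      if "degree g < N" for g
      by (rule heine_poly_orthogonal[OF _ injI that]) simp
  qed (rule that)
  show ?thesis
  proof (rule that[of \<delta> v z])
    show "v n C1_differentiable_on {-\<delta><..<\<delta>}" "z n C1_differentiable_on {-\<delta><..<\<delta>}" if "n \<in> {1..N}" for n
      using v_C1[OF that] z_C1'[OF that] \<delta> by (auto intro: C1_differentiable_on_subset)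
  next
    fix n \<epsilon> assume "n \<in> {1..N}" "\<bar>\<epsilon>\<bar> < \<delta>"
    then show "v n \<epsilon> \<noteq> 0 \<and> z n \<epsilon> > 0"
      using ev2[of \<epsilon>] ev4[of \<epsilon>] \<delta> \<delta>3 by auto
  next
    fix i j \<epsilon> assume "i \<in> {1..N}" "j \<in> {1..N}" "i < j" "\<bar>\<epsilon>\<bar> < \<delta>"
    then show "z j \<epsilon> < z i \<epsilon>"
      using ev2[of \<epsilon>] \<delta> \<delta>3 by auto
  qed (use \<delta> v0 z0 quad in auto)
qed

section \<open>Uniqueness of discrete measures with given moments\<close>

lemma power_sums_imp_poly_sums:
  fixes v z w x :: "_ \<Rightarrow> real"
  assumes "\<And>k. k < K \<Longrightarrow> (\<Sum>n\<in>J. v n * z n ^ k) = (\<Sum>i\<in>I. w i * x i ^ k)" and "degree f < K"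
  shows "(\<Sum>n\<in>J. v n * poly f (z n)) = (\<Sum>i\<in>I. w i * poly f (x i))"
proof -
  have swap: "(\<Sum>n\<in>J. v n * poly f (z n)) = (\<Sum>k\<le>degree f. coeff f k * (\<Sum>n\<in>J. v n * z n ^ k))"
    for J :: "'c set" and v z :: "'c \<Rightarrow> real"
    unfolding poly_altdef sum_distrib_left by (subst sum.swap) (simp add: mult_ac)
  show ?thesis
    unfolding swap by (intro sum.cong refl) (use assms in simp)
qed

text \<open>
  The relation between the two sums extends from powers to all polynomials of degree below \<open>2 * N\<close>. A
  node \<open>z m\<close> that is not among the \<open>z' n\<close> is isolated by the polynomial that vanishes at all
  other points of both families, of degree \<open>2 * N - 1\<close>, which contradicts \<open>v m \<noteq> 0\<close>. Counting then shows that the nodes \<open>z' n\<close> are a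
  renumbering of the \<open>z n\<close>. In particular the \<open>z' n\<close> are distinct, and
  the same kind of test applies to the weights.
\<close>

lemma power_sums_determine_nodes:
  fixes v z v' z' :: "nat \<Rightarrow> real"
  assumes inj: "inj_on z {1..N}" and nz: "\<And>n. n \<in> {1..N} \<Longrightarrow> v n \<noteq> 0"
    and eq: "\<And>k. k < 2 * N \<Longrightarrow> (\<Sum>n=1..N. v n * z n ^ k) = (\<Sum>n=1..N. v' n * z' n ^ k)"
  shows "\<exists>\<sigma>. \<sigma> permutes {1..N} \<and> (\<forall>n\<in>{1..N}. v' n = v (\<sigma> n) \<and> z' n = z (\<sigma> n))"
proof -
  let ?J = "{1..N}"
  have polys: "(\<Sum>n=1..N. v n * poly f (z n)) = (\<Sum>n=1..N. v' n * poly f (z' n))"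
    if "degree f < 2 * N" for f
    using power_sums_imp_poly_sums[OF eq that] by simp
  have vanish: "poly (node_poly u T) t = 0" if "t \<in> u ` T" "finite T" for u :: "nat \<Rightarrow> real" and T t
    using that by (auto simp: poly_node_poly)
  have subset: "z ` ?J \<subseteq> z' ` ?J"
  proof (rule ccontr)
    assume "\<not> z ` ?J \<subseteq> z' ` ?J"
    then obtain m where m: "m \<in> ?J" "z m \<notin> z' ` ?J"
      by blast
    define f where "f = node_poly z (?J - {m}) * node_poly z' ?J"
    have "degree f \<le> card (?J - {m}) + card ?J"
      unfolding f_def by (rule order.trans[OF degree_mult_le]) (simp add: degree_node_poly)
    then have "degree f < 2 * N"
      using m(1) by auto
    moreover have "poly f (z' n) = 0" if "n \<in> ?J" for n
      using vanish[of "z' n" z' ?J] that by (simp add: f_def)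
    moreover have "poly f (z n) = 0" if "n \<in> ?J" "n \<noteq> m" for n
      using vanish[of "z n" z "?J - {m}"] that by (simp add: f_def)
    then have "(\<Sum>n=1..N. v n * poly f (z n)) = v m * poly f (z m)"
      using m(1) by (subst sum.remove[of _ m]) (auto intro!: sum.neutral)
    ultimately have "v m * poly f (z m) = 0"
      using polys[of f] by simp
    moreover have "poly f (z m) \<noteq> 0"
      using m inj by (auto simp: f_def poly_node_poly inj_on_eq_iff)
    ultimately show False
      using nz m(1) by simp
  qed
  have card_z: "card (z ` ?J) = N"
    using inj by (simp add: card_image)
  have card_z': "card (z' ` ?J) = N"
    using card_mono[OF _ subset] card_image_le[of ?J z'] card_z by simp
  have images: "z' ` ?J = z ` ?J"
    using card_subset_eq[OF _ subset] card_z card_z' by simp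
  have inj': "inj_on z' ?J"
    using card_z' by (intro eq_card_imp_inj_on) auto
  define \<sigma> where "\<sigma> = (\<lambda>n. if n \<in> ?J then inv_into ?J z (z' n) else n)"
  have \<sigma>: "\<sigma> n \<in> ?J" "z (\<sigma> n) = z' n" if "n \<in> ?J" for n
  proof -
    have "z' n \<in> z ` ?J"
      using that images by blast
    then show "\<sigma> n \<in> ?J" "z (\<sigma> n) = z' n"
      unfolding \<sigma>_def using that by (simp_all only: if_True inv_into_into f_inv_into_f)
  qed
  have inj_\<sigma>: "inj_on \<sigma> ?J"
    by (rule inj_onI) (metis \<sigma>(2) inj' inj_onD)
  have "\<sigma> ` ?J = ?J"
    using \<sigma>(1) by (intro endo_inj_surj inj_\<sigma>) auto
  then have perm: "\<sigma> permutes ?J"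
  proof (intro bij_imp_permutes)
    show "bij_betw \<sigma> ?J ?J"
      using inj_\<sigma> \<open>\<sigma> ` ?J = ?J\<close> by (simp add: bij_betw_def)
    show "\<sigma> n = n" if "n \<notin> ?J" for n
      using that by (simp only: \<sigma>_def if_False)
  qed
  \<comment> \<open>Test with the polynomial that vanishes at all nodes but \<open>z' m\<close>.\<close>
  have "v' m = v (\<sigma> m)" if m: "m \<in> ?J" for m
  proof -
    define f where "f = node_poly z' (?J - {m})"
    have "degree f < 2 * N"
      using m by (auto simp: f_def degree_node_poly)
    moreover have other: "poly f (z' n) = 0" if "n \<in> ?J" "n \<noteq> m" for n
      using vanish[of "z' n" z' "?J - {m}"] that by (simp add: f_def)
    moreover have "(\<Sum>n=1..N. v n * poly f (z n)) = (\<Sum>n=1..N. v (\<sigma> n) * poly f (z (\<sigma> n)))"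
      by (rule sum.permute[OF perm, unfolded o_def])
    ultimately have "(\<Sum>n=1..N. v (\<sigma> n) * poly f (z' n)) = (\<Sum>n=1..N. v' n * poly f (z' n))"
      using polys[of f] \<sigma>(2) by simp
    moreover have "(\<Sum>n=1..N. u n * poly f (z' n)) = u m * poly f (z' m)" for u :: "nat \<Rightarrow> real"
      using m other by (subst sum.remove[of _ m]) (auto intro!: sum.neutral)
    moreover have "poly f (z' m) \<noteq> 0"
      using m inj' by (auto simp: f_def poly_node_poly inj_on_eq_iff)
    ultimately show ?thesis
      by simp
  qed
  then show ?thesis
    using perm \<sigma>(2) by (intro exI[of _ \<sigma>]) simp
qed

text \<open>
  Both \<open>\<sigma>\<close> and its inverse are strictly increasing on the natural numbers, and such a map never lies below the
  identity.
\<close>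

lemma strict_mono_permutation_eq_id:
  fixes \<sigma> :: "nat \<Rightarrow> nat"
  assumes perm: "\<sigma> permutes {1..N}" and mono: "strict_mono_on {1..N} \<sigma>"
  shows "\<sigma> n = n"
proof -
  have in_iff: "\<sigma> i \<in> {1..N} \<longleftrightarrow> i \<in> {1..N}" for i
    by (rule permutes_in_image[OF perm])
  have out: "\<sigma> i = i" if "i \<notin> {1..N}" for i
    using permutes_not_in[OF perm that] .
  have sm: "strict_mono \<sigma>"
  proof (rule strict_monoI)
    fix i j :: nat assume "i < j"
    then show "\<sigma> i < \<sigma> j"
      using strict_mono_onD[OF mono, of i j] out[of i] out[of j] in_iff[of i] in_iff[of j]
      by (cases "i \<in> {1..N}"; cases "j \<in> {1..N}") auto
  qed
  have inv: "strict_mono (inv \<sigma>)"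
    using permutes_inverses(1)[OF perm] strict_mono_less[OF sm]
    by (intro strict_monoI) metis
  have "inv \<sigma> n \<le> \<sigma> (inv \<sigma> n)" "n \<le> inv \<sigma> n" "n \<le> \<sigma> n" "\<sigma> n \<le> inv \<sigma> (\<sigma> n)"
    using strict_mono_imp_increasing sm inv by blast+
  then show ?thesis
    using permutes_inverses(2)[OF perm] by simp
qed

section \<open>First-order variation of the quadrature rule\<close>

text \<open>
  The rule and the perturbed measure agree on \<open>f\<close> for all small \<open>\<epsilon>\<close>, and the integral of \<open>f\<close> is affine in
  \<open>\<epsilon>\<close>; both sides are compared through their derivatives at zero.
\<close>

lemma perturbed_quadrature_derivative:
  fixes v z :: "nat \<Rightarrow> real \<Rightarrow> real"
  assumes \<delta>: "\<delta> > 0"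
    and v: "\<And>n. n \<in> {1..N} \<Longrightarrow> v n C1_differentiable_on {-\<delta><..<\<delta>}"
    and z: "\<And>n. n \<in> {1..N} \<Longrightarrow> z n C1_differentiable_on {-\<delta><..<\<delta>}"
    and quad: "\<And>\<epsilon>. \<bar>\<epsilon>\<bar> < \<delta> \<Longrightarrow> (\<Sum>n=1..N. v n \<epsilon> * poly f (z n \<epsilon>)) =
       (\<Sum>i=1..N+M. perturbed_weight N y \<epsilon> i * poly f (x i))"
  shows "(\<Sum>n=1..N. deriv (v n) 0 * poly f (z n 0) + v n 0 * (poly (pderiv f) (z n 0) * deriv (z n) 0)) =
     (\<Sum>m=N+1..N+M. y m * poly f (x m))"
proof (rule DERIV_unique)
  let ?G = "\<lambda>\<epsilon>. \<Sum>n=1..N. v n \<epsilon> * poly f (z n \<epsilon>)"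
  let ?c = "\<Sum>n=1..N. y n * poly f (x n)" and ?s = "\<Sum>m=N+1..N+M. y m * poly f (x m)"
  have "(v n has_real_derivative deriv (v n) 0) (at 0)" "(z n has_real_derivative deriv (z n) 0) (at 0)"
    if "n \<in> {1..N}" for n
    using C1_differentiable_on_imp_DERIV[OF v[OF that]] C1_differentiable_on_imp_DERIV[OF z[OF that]] \<delta>
    by auto
  then show "(?G has_real_derivative
      (\<Sum>n=1..N. deriv (v n) 0 * poly f (z n 0) + v n 0 * (poly (pderiv f) (z n 0) * deriv (z n) 0))) (at 0)"
    by (intro DERIV_sum) (auto intro!: derivative_eq_intros DERIV_chain2[OF poly_DERIV])
  have "((\<lambda>\<epsilon>. ?c + \<epsilon> * ?s) has_real_derivative ?s) (at 0)"
    by (auto intro!: derivative_eq_intros)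
  then show "(?G has_real_derivative ?s) (at 0)"
  proof (rule has_field_derivative_transform_within_open[where S = "{-\<delta><..<\<delta>}"])
    fix \<epsilon> assume "\<epsilon> \<in> {-\<delta><..<\<delta>}"
    then have "?G \<epsilon> = (\<Sum>i=1..N+M. perturbed_weight N y \<epsilon> i * poly f (x i))"
      by (intro quad) (simp add: abs_less_iff)
    also have "\<dots> = ?c + \<epsilon> * ?s"
      by (rule sum_perturbed_weight)
    finally show "?c + \<epsilon> * ?s = ?G \<epsilon>" ..
  qed (use \<delta> in auto)
qed

text \<open>
  The Hermite basis functions as polynomial objects, which makes their degrees and their formal
  derivatives available.
\<close>

definition hermite_poly :: "(nat \<Rightarrow> real) \<Rightarrow> nat \<Rightarrow> nat \<Rightarrow> real poly" where
  "hermite_poly \<phi> N n = (let L = lagrange_poly \<phi> N n; c = poly (pderiv L) (\<phi> n)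
     in [:1 + 2 * c * \<phi> n, - 2 * c:] * (L * L))"

definition hermite_poly_tilde :: "(nat \<Rightarrow> real) \<Rightarrow> nat \<Rightarrow> nat \<Rightarrow> real poly" where
  "hermite_poly_tilde \<phi> N n = [:- \<phi> n, 1:] * (lagrange_poly \<phi> N n * lagrange_poly \<phi> N n)"

lemma degree_linear_mult_square_less:
  fixes L :: "real poly"
  assumes "degree L < N"
  shows "degree ([:a, b:] * (L * L)) < 2 * N"
proof -
  have "degree ([:a, b:] * (L * L)) \<le> degree [:a, b:] + (degree L + degree L)"
    by (rule order.trans[OF degree_mult_le]) (simp add: degree_mult_le)
  also have "\<dots> \<le> 1 + (degree L + degree L)"
    by simp
  finally show ?thesis
    using assms by linarith
qed

lemma poly_hermite_poly: "poly (hermite_poly \<phi> N n) t = hermite_basis \<phi> N n t"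
proof -
  have "deriv (lagrange_basis \<phi> N n) t = poly (pderiv (lagrange_poly \<phi> N n)) t" for t
    unfolding poly_lagrange_poly[symmetric] by (rule DERIV_imp_deriv[OF poly_DERIV])
  then show ?thesis
    by (simp add: hermite_poly_def hermite_basis_def poly_lagrange_poly Let_def power2_eq_square algebra_simps)
qed

lemma poly_hermite_poly_tilde: "poly (hermite_poly_tilde \<phi> N n) t = hermite_basis_tilde \<phi> N n t"
  by (simp add: hermite_poly_tilde_def hermite_basis_tilde_def poly_lagrange_poly power2_eq_square algebra_simps)

text \<open>
  Duality with the functionals \<open>f \<mapsto> f(\<phi> j)\<close> and \<open>f \<mapsto> f'(\<phi> j)\<close>. The linear factor in the
  Hermite polynomial is chosen to cancel the derivative \<open>2 L'(\<phi> n)\<close> of the square of the Lagrange polynomial at its own node.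
\<close>

lemma hermite_poly_nodes:
  assumes "inj_on \<phi> {1..N}" "n \<in> {1..N}" "j \<in> {1..N}"
  shows "poly (hermite_poly \<phi> N n) (\<phi> j) = (if j = n then 1 else 0)"
    and "poly (pderiv (hermite_poly \<phi> N n)) (\<phi> j) = 0"
    and "poly (hermite_poly_tilde \<phi> N n) (\<phi> j) = 0"
    and "poly (pderiv (hermite_poly_tilde \<phi> N n)) (\<phi> j) = (if j = n then 1 else 0)"
proof -
  have L: "poly (lagrange_poly \<phi> N n) (\<phi> j) = (if j = n then 1 else 0)"
    using lagrange_basis_node[OF assms] by (simp add: poly_lagrange_poly)
  show "poly (hermite_poly \<phi> N n) (\<phi> j) = (if j = n then 1 else 0)"
    by (simp add: hermite_poly_def Let_def L algebra_simps)
  show "poly (pderiv (hermite_poly \<phi> N n)) (\<phi> j) = 0"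
    unfolding hermite_poly_def Let_def pderiv_mult by (simp add: L pderiv_pCons algebra_simps)
  show "poly (hermite_poly_tilde \<phi> N n) (\<phi> j) = 0"
    by (simp add: hermite_poly_tilde_def L)
  show "poly (pderiv (hermite_poly_tilde \<phi> N n)) (\<phi> j) = (if j = n then 1 else 0)"
    unfolding hermite_poly_tilde_def pderiv_mult by (simp add: L pderiv_pCons algebra_simps)
qed

section \<open>The perturbed Prony system\<close>

text \<open>
  In the variables \<open>exp (- l' n * \<Delta>)\<close> the system is an equality of moments.
\<close>

lemma prony_zero_iff_power_sums:
  "prony_zero N M \<Delta> y lam y' l' \<epsilon> \<longleftrightarrow>
     (\<forall>k<2*N. (\<Sum>n=1..N. y' n * node \<Delta> l' n ^ k) =
        (\<Sum>i=1..N+M. perturbed_weight N y \<epsilon> i * node \<Delta> lam i ^ k))"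
proof -
  have "exp (- l n * real k * \<Delta>) = node \<Delta> l n ^ k" for l n k
    by (simp add: node_def exp_of_nat_mult[symmetric] mult_ac)
  then show ?thesis
    unfolding prony_zero_def prony_map_def sum_perturbed_weight by (simp only: diff_diff_eq right_minus_eq)
qed

theorem theorem1:
  fixes p q :: "real \<Rightarrow> real"
    and lam y :: "nat \<Rightarrow> real"
    and N1 N2 :: nat
    and \<Delta> \<l> M\<^sub>y :: real
  assumes "smooth_unit_interval p" and "smooth_unit_interval q"
    and "\<forall>x\<in>{0..1}. p x > 0"
    and "SL_eigenvalue_sequence p q lam"
    and "\<Delta> > 0"
    and "\<l> > 1"
    and "\<forall>n\<in>{1..N1}. 1 / \<l> \<le> \<bar>y n\<bar> \<and> \<bar>y n\<bar> \<le> \<l>"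
    and "M\<^sub>y > 0"
    and "\<forall>k\<in>{1..N1}. \<forall>n\<in>{N1+1..N1+N2}. \<bar>y n\<bar> / \<bar>y k\<bar> \<le> M\<^sub>y"
  shows "\<exists>\<epsilon>\<^sub>0>0. \<exists>yh lh :: nat \<Rightarrow> real \<Rightarrow> real.
      (\<forall>n\<in>{1..N1}. yh n C1_differentiable_on {-\<epsilon>\<^sub>0<..<\<epsilon>\<^sub>0} \<and> lh n C1_differentiable_on {-\<epsilon>\<^sub>0<..<\<epsilon>\<^sub>0})
    \<and> (\<forall>n\<in>{1..N1}. yh n 0 = y n \<and> lh n 0 = lam n)
    \<and> (\<forall>\<epsilon>\<in>{-\<epsilon>\<^sub>0<..<\<epsilon>\<^sub>0}.
          strict_mono_on {1..N1} (\<lambda>n. lh n \<epsilon>)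
        \<and> (\<forall>y' l' :: nat \<Rightarrow> real. strict_mono_on {1..N1} l' \<longrightarrow>
             (prony_zero N1 N2 \<Delta> y lam y' l' \<epsilon> \<longleftrightarrow>
                (\<forall>n\<in>{1..N1}. y' n = yh n \<epsilon> \<and> l' n = lh n \<epsilon>)))
        \<and> (\<forall>y' l' :: nat \<Rightarrow> real.
             prony_zero N1 N2 \<Delta> y lam y' l' \<epsilon> \<longleftrightarrow>
                (\<exists>\<sigma>. \<sigma> permutes {1..N1} \<and>
                   (\<forall>n\<in>{1..N1}. y' n = yh (\<sigma> n) \<epsilon> \<and> l' n = lh (\<sigma> n) \<epsilon>))))
    \<and> (\<forall>n\<in>{1..N1}.
          deriv (yh n) 0 =
            (\<Sum>m=N1+1..N1+N2. y m * hermite_basis (node \<Delta> lam) N1 n (node \<Delta> lam m))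
        \<and> deriv (lh n) 0 =
            - (1 / (\<Delta> * y n * node \<Delta> lam n)) *
            (\<Sum>m=N1+1..N1+N2. y m * hermite_basis_tilde (node \<Delta> lam) N1 n (node \<Delta> lam m)))"
proof -
  define \<phi> where "\<phi> = node \<Delta> lam"
  have \<Delta>: "\<Delta> > 0"
    by fact
  have lam_mono: "lam i < lam j" if "1 \<le> i" "i < j" for i j
    using assms(4) that unfolding SL_eigenvalue_sequence_def
    by (auto intro: strict_mono_onD[of "{1..}"])
  have \<phi>_dec: "\<phi> j < \<phi> i" if "1 \<le> i" "i < j" for i j
    using lam_mono[OF that] \<Delta> by (simp add: \<phi>_def node_def)
  have \<phi>_pos: "\<phi> i > 0" for i
    by (simp add: \<phi>_def node_def)
  have y_nz: "y n \<noteq> 0" if "n \<in> {1..N1}" for n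
  proof -
    have "0 < 1 / \<l>" "1 / \<l> \<le> \<bar>y n\<bar>"
      using assms(6,7) that by auto
    then show ?thesis
      by linarith
  qed
  have \<phi>_inj: "inj_on \<phi> {1..N1}"
    by (intro linorder_inj_onI) (use \<phi>_dec in \<open>force+\<close>)
  obtain \<delta> v z where \<delta>: "\<delta> > 0"
    and v_C1: "\<And>n. n \<in> {1..N1} \<Longrightarrow> v n C1_differentiable_on {-\<delta><..<\<delta>}"
    and z_C1: "\<And>n. n \<in> {1..N1} \<Longrightarrow> z n C1_differentiable_on {-\<delta><..<\<delta>}"
    and v0: "\<And>n. n \<in> {1..N1} \<Longrightarrow> v n 0 = y n"
    and z0: "\<And>n. n \<in> {1..N1} \<Longrightarrow> z n 0 = \<phi> n"
    and nondeg: "\<And>n \<epsilon>. n \<in> {1..N1} \<Longrightarrow> \<bar>\<epsilon>\<bar> < \<delta> \<Longrightarrow> v n \<epsilon> \<noteq> 0 \<and> z n \<epsilon> > 0"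
    and z_dec: "\<And>i j \<epsilon>. i \<in> {1..N1} \<Longrightarrow> j \<in> {1..N1} \<Longrightarrow> i < j \<Longrightarrow> \<bar>\<epsilon>\<bar> < \<delta> \<Longrightarrow> z j \<epsilon> < z i \<epsilon>"
    and quad: "\<And>f \<epsilon>. degree f < 2 * N1 \<Longrightarrow> \<bar>\<epsilon>\<bar> < \<delta> \<Longrightarrow>
       (\<Sum>n=1..N1. v n \<epsilon> * poly f (z n \<epsilon>)) =
       (\<Sum>i=1..N1+N2. perturbed_weight N1 y \<epsilon> i * poly f (\<phi> i))"
  proof (rule perturbed_quadrature[where x = \<phi> and y = y and N = N1 and M = N2], goal_cases)
    case (4 \<delta> v z)
    show ?case
      by (rule that) (rule 4; assumption)+
  qed (rule \<phi>_dec \<phi>_pos y_nz; assumption)+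
  \<comment> \<open>Exponents are recovered from points by \<open>z = exp (- lh \<Delta>)\<close>, which reverses the order.\<close>
  define lh where "lh = (\<lambda>n \<epsilon>. - ln (z n \<epsilon>) / \<Delta>)"
  have node_lh: "node \<Delta> (\<lambda>n. lh (\<sigma> n) \<epsilon>) n = z (\<sigma> n) \<epsilon>" if "\<sigma> n \<in> {1..N1}" "\<bar>\<epsilon>\<bar> < \<delta>" for n \<epsilon> \<sigma>
    using nondeg[OF that] \<Delta> by (simp add: node_def lh_def)
  have exponent_eq: "l' n = - ln (node \<Delta> l' n) / \<Delta>" for l' n
    using \<Delta> by (simp add: node_def)
  have lh_C1: "lh n C1_differentiable_on {-\<delta><..<\<delta>}" if "n \<in> {1..N1}" for n
    unfolding lh_def using z_C1[OF that] nondeg[OF that] \<Delta>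
    by (intro C1_differentiable_on_divide C1_differentiable_on_minus C1_differentiable_on_ln
        C1_differentiable_on_const) (auto simp: abs_less_iff)
  have lh0: "lh n 0 = lam n" if "n \<in> {1..N1}" for n
    using z0[OF that] exponent_eq[of lam n] by (simp add: lh_def \<phi>_def)
  have lh_mono: "strict_mono_on {1..N1} (\<lambda>n. lh n \<epsilon>)" if "\<bar>\<epsilon>\<bar> < \<delta>" for \<epsilon>
  proof (rule strict_mono_onI)
    fix i j assume ij: "i \<in> {1..N1}" "j \<in> {1..N1}" "i < j"
    then have "ln (z j \<epsilon>) < ln (z i \<epsilon>)"
      using z_dec[OF ij that] nondeg that by simp
    then show "lh i \<epsilon> < lh j \<epsilon>"
      using \<Delta> by (simp add: lh_def divide_strict_right_mono)
  qed
  have zero_iff: "prony_zero N1 N2 \<Delta> y lam y' l' \<epsilon> \<longleftrightarrow>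
      (\<forall>k<2*N1. (\<Sum>n=1..N1. v n \<epsilon> * z n \<epsilon> ^ k) = (\<Sum>n=1..N1. y' n * node \<Delta> l' n ^ k))"
    if "\<bar>\<epsilon>\<bar> < \<delta>" for y' l' \<epsilon>
  proof -
    have moments: "(\<Sum>n=1..N1. v n \<epsilon> * z n \<epsilon> ^ k) = (\<Sum>i=1..N1+N2. perturbed_weight N1 y \<epsilon> i * \<phi> i ^ k)"
      if "k < 2 * N1" for k
      using quad[of "monom 1 k" \<epsilon>] \<open>\<bar>\<epsilon>\<bar> < \<delta>\<close> that by (simp add: poly_monom degree_monom_eq)
    show ?thesis
      unfolding prony_zero_iff_power_sums \<phi>_def[symmetric]
      by (intro arg_cong[where f = All] ext imp_cong refl) (simp only: moments eq_commute)
  qed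
  have all_solutions: "prony_zero N1 N2 \<Delta> y lam y' l' \<epsilon> \<longleftrightarrow>
      (\<exists>\<sigma>. \<sigma> permutes {1..N1} \<and> (\<forall>n\<in>{1..N1}. y' n = v (\<sigma> n) \<epsilon> \<and> l' n = lh (\<sigma> n) \<epsilon>))"
    if \<epsilon>: "\<bar>\<epsilon>\<bar> < \<delta>" for y' l' \<epsilon>
  proof
    assume "prony_zero N1 N2 \<Delta> y lam y' l' \<epsilon>"
    then have sums: "(\<Sum>n=1..N1. v n \<epsilon> * z n \<epsilon> ^ k) = (\<Sum>n=1..N1. y' n * node \<Delta> l' n ^ k)"
      if "k < 2 * N1" for k
      using zero_iff[OF \<epsilon>] that by blast
    have "inj_on (\<lambda>n. z n \<epsilon>) {1..N1}"
      by (intro linorder_inj_onI) (use z_dec \<epsilon> in \<open>force+\<close>)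
    from power_sums_determine_nodes[OF this _ sums] nondeg[OF _ \<epsilon>]
    obtain \<sigma> where \<sigma>: "\<sigma> permutes {1..N1}"
      "\<And>n. n \<in> {1..N1} \<Longrightarrow> y' n = v (\<sigma> n) \<epsilon> \<and> node \<Delta> l' n = z (\<sigma> n) \<epsilon>"
      by blast
    then have "l' n = lh (\<sigma> n) \<epsilon>" if "n \<in> {1..N1}" for n
      using exponent_eq[of l' n] that by (simp add: lh_def)
    with \<sigma> show "\<exists>\<sigma>. \<sigma> permutes {1..N1} \<and> (\<forall>n\<in>{1..N1}. y' n = v (\<sigma> n) \<epsilon> \<and> l' n = lh (\<sigma> n) \<epsilon>)"
      by blast
  next
    assume "\<exists>\<sigma>. \<sigma> permutes {1..N1} \<and> (\<forall>n\<in>{1..N1}. y' n = v (\<sigma> n) \<epsilon> \<and> l' n = lh (\<sigma> n) \<epsilon>)"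
    then obtain \<sigma> where perm: "\<sigma> permutes {1..N1}"
      and \<sigma>: "\<And>n. n \<in> {1..N1} \<Longrightarrow> y' n = v (\<sigma> n) \<epsilon> \<and> l' n = lh (\<sigma> n) \<epsilon>"
      by blast
    have "(\<Sum>n=1..N1. v n \<epsilon> * z n \<epsilon> ^ k) = (\<Sum>n=1..N1. y' n * node \<Delta> l' n ^ k)" for k
    proof -
      have "(\<Sum>n=1..N1. v n \<epsilon> * z n \<epsilon> ^ k) = (\<Sum>n=1..N1. v (\<sigma> n) \<epsilon> * z (\<sigma> n) \<epsilon> ^ k)"
        by (rule sum.permute[OF perm, unfolded o_def])
      also have "\<dots> = (\<Sum>n=1..N1. y' n * node \<Delta> l' n ^ k)"
      proof (intro sum.cong refl)
        fix n assume n: "n \<in> {1..N1}"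
        then have "\<sigma> n \<in> {1..N1}"
          using permutes_in_image[OF perm] by blast
        then have "node \<Delta> l' n = z (\<sigma> n) \<epsilon>"
          using node_lh[of \<sigma> n \<epsilon>] \<sigma>[OF n] \<epsilon> by (simp add: node_def)
        then show "v (\<sigma> n) \<epsilon> * z (\<sigma> n) \<epsilon> ^ k = y' n * node \<Delta> l' n ^ k"
          using \<sigma>[OF n] by simp
      qed
      finally show ?thesis .
    qed
    then show "prony_zero N1 N2 \<Delta> y lam y' l' \<epsilon>"
      using zero_iff[OF \<epsilon>] by blast
  qed
  have ordered_solution: "prony_zero N1 N2 \<Delta> y lam y' l' \<epsilon> \<longleftrightarrow>
      (\<forall>n\<in>{1..N1}. y' n = v n \<epsilon> \<and> l' n = lh n \<epsilon>)"
    if \<epsilon>: "\<bar>\<epsilon>\<bar> < \<delta>" and l': "strict_mono_on {1..N1} l'" for y' l' \<epsilon>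
  proof
    assume "prony_zero N1 N2 \<Delta> y lam y' l' \<epsilon>"
    then obtain \<sigma> where perm: "\<sigma> permutes {1..N1}"
      and \<sigma>: "\<And>n. n \<in> {1..N1} \<Longrightarrow> y' n = v (\<sigma> n) \<epsilon> \<and> l' n = lh (\<sigma> n) \<epsilon>"
      using all_solutions[OF \<epsilon>] by blast
    have "strict_mono_on {1..N1} \<sigma>"
    proof (rule strict_mono_onI)
      fix i j assume ij: "i \<in> {1..N1}" "j \<in> {1..N1}" "i < j"
      then have "lh (\<sigma> i) \<epsilon> < lh (\<sigma> j) \<epsilon>"
        using strict_mono_onD[OF l' ij] \<sigma> by simp
      then show "\<sigma> i < \<sigma> j"
        using strict_mono_on_less[OF lh_mono[OF \<epsilon>], of "\<sigma> i" "\<sigma> j"] ij permutes_in_image[OF perm]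
        by blast
    qed
    then have "\<sigma> n = n" for n
      using strict_mono_permutation_eq_id[OF perm] by blast
    then show "\<forall>n\<in>{1..N1}. y' n = v n \<epsilon> \<and> l' n = lh n \<epsilon>"
      using \<sigma> by simp
  next
    assume "\<forall>n\<in>{1..N1}. y' n = v n \<epsilon> \<and> l' n = lh n \<epsilon>"
    then show "prony_zero N1 N2 \<Delta> y lam y' l' \<epsilon>"
      unfolding all_solutions[OF \<epsilon>] by (intro exI[of _ id] conjI permutes_id) simp
  qed
  have moment_derivative: "(\<Sum>j=1..N1. deriv (v j) 0 * poly f (\<phi> j) + y j * (poly (pderiv f) (\<phi> j) * deriv (z j) 0)) =
      (\<Sum>m=N1+1..N1+N2. y m * poly f (\<phi> m))" if "degree f < 2 * N1" for f
    using perturbed_quadrature_derivative[OF \<delta> v_C1 z_C1 quad[OF that]] v0 z0 by simp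
  \<comment> \<open>The function \<open>hermite_basis \<phi> N1 n\<close> has value 1 at \<open>\<phi> n\<close>, and its other values and all its derivatives at the nodes are zero.\<close>
  have deriv_v: "deriv (v n) 0 = (\<Sum>m=N1+1..N1+N2. y m * hermite_basis \<phi> N1 n (\<phi> m))"
    if n: "n \<in> {1..N1}" for n
  proof -
    have "degree (hermite_poly \<phi> N1 n) < 2 * N1"
      unfolding hermite_poly_def Let_def by (intro degree_linear_mult_square_less degree_lagrange_poly n)
    from moment_derivative[OF this]
    have "(\<Sum>j=1..N1. deriv (v j) 0 * (if j = n then 1 else 0)) =
        (\<Sum>m=N1+1..N1+N2. y m * hermite_basis \<phi> N1 n (\<phi> m))"
      using hermite_poly_nodes[OF \<phi>_inj n] by (simp add: poly_hermite_poly)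
    moreover have "(\<Sum>j=1..N1. deriv (v j) 0 * (if j = n then 1 else 0)) = deriv (v n) 0"
      using n by (simp add: if_distrib cong: if_cong)
    ultimately show ?thesis
      by simp
  qed
  \<comment> \<open>The function \<open>hermite_basis_tilde \<phi> N1 n\<close> has derivative 1 at \<open>\<phi> n\<close>, and its values and its other derivatives at the nodes are zero.\<close>
  have deriv_z: "y n * deriv (z n) 0 = (\<Sum>m=N1+1..N1+N2. y m * hermite_basis_tilde \<phi> N1 n (\<phi> m))"
    if n: "n \<in> {1..N1}" for n
  proof -
    have "degree (hermite_poly_tilde \<phi> N1 n) < 2 * N1"
      unfolding hermite_poly_tilde_def by (intro degree_linear_mult_square_less degree_lagrange_poly n)
    from moment_derivative[OF this]
    have "(\<Sum>j=1..N1. y j * ((if j = n then 1 else 0) * deriv (z j) 0)) =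
        (\<Sum>m=N1+1..N1+N2. y m * hermite_basis_tilde \<phi> N1 n (\<phi> m))"
      using hermite_poly_nodes[OF \<phi>_inj n] by (simp add: poly_hermite_poly_tilde)
    moreover have "(\<Sum>j=1..N1. y j * ((if j = n then 1 else 0) * deriv (z j) 0)) = y n * deriv (z n) 0"
      using n by (simp add: if_distrib if_distribR cong: if_cong)
    ultimately show ?thesis
      by simp
  qed
  have deriv_lh: "deriv (lh n) 0 = - (1 / (\<Delta> * y n * \<phi> n)) *
      (\<Sum>m=N1+1..N1+N2. y m * hermite_basis_tilde \<phi> N1 n (\<phi> m))" if n: "n \<in> {1..N1}" for n
  proof -
    have "(z n has_real_derivative deriv (z n) 0) (at 0)"
      using C1_differentiable_on_imp_DERIV[OF z_C1[OF n]] \<delta> by simp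
    then have "(lh n has_real_derivative - (1 / \<phi> n * deriv (z n) 0) / \<Delta>) (at 0)"
      unfolding lh_def using z0[OF n] \<phi>_pos[of n] \<Delta>
      by (auto intro!: derivative_eq_intros)
    then have "deriv (lh n) 0 = - (1 / \<phi> n * deriv (z n) 0) / \<Delta>"
      by (rule DERIV_imp_deriv)
    also have "\<dots> = - (1 / (\<Delta> * y n * \<phi> n)) * (y n * deriv (z n) 0)"
      using y_nz[OF n] \<phi>_pos[of n] \<Delta> by (simp add: field_simps)
    finally show ?thesis
      unfolding deriv_z[OF n] .
  qed
  show ?thesis
    by (rule exI[of _ \<delta>], intro conjI \<delta> exI[of _ v] exI[of _ lh] ballI allI impI)
       (use v_C1 lh_C1 v0 lh0 lh_mono ordered_solution all_solutions deriv_v deriv_lh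
        in \<open>simp_all add: \<phi>_def abs_less_iff\<close>)
qed

end
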